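(* For every $k\geq2$, with $t=\frac{1}{2\sqrt{x}}$, $$\Phi_{12\mbox{-}3\mbox{-}\cdots\mbox{-}k}(x)=\frac{1}{U_2(t)U_k^2(t)}\left[1+\sum_{i=2}^{k-1}\frac{2\sqrt{x}}{U_i(t)U_{i+1}(t)}\left(\sum_{j=1}^{i}U_j^2(t)-1\right)\right].$$
   Context: A generalized pattern is a permutation of $\{1,\dots,k\}$ written as a word $\tau_1\cdots\tau_k$ in which each pair of adjacent letters may or may not be separated by a dash "-". An occurrence of $\tau$ in $\pi=\pi_1\cdots\pi_n\in S_n$ is a choice of indices $i_1<\dots<i_k$ with $(\pi_{i_1},\dots,\pi_{i_k})$ order-isomorphic to $(\tau_1,\dots,\tau_k)$ and $i_{j+1}=i_j+1$ whenever $\tau_j,\tau_{j+1}$ are not separated by a dash. $1\mbox{-}3\mbox{-}2$ is the classical pattern $132$. $\Phi_\tau(x)=\sum_{n\geq0}\varphi_\tau(n)x^n$ where $\varphi_\tau(n)$ is the number of permutations in $S_n$ having exactly one occurrence of $1\mbox{-}3\mbox{-}2$ and exactly one occurrence of $\tau$. $U_p$ is the Chebyshev polynomial of the second kind, $U_p(\cos\theta)=\sin((p+1)\theta)/\sin\theta$. *)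

theory Defs
  imports
    "HOL-Analysis.Analysis"
    "HOL-Computational_Algebra.Computational_Algebra"
    "HOL-Combinatorics.Permutations"
begin

section \<open>Generalized patterns\<close>

text \<open>
  A generalized pattern of length \<open>k\<close> is a pair \<open>(w, d)\<close>: the word \<open>w\<close> of letters and the list
  \<open>d\<close> of length \<open>k - 1\<close>, where \<open>d ! j\<close> says whether there is a dash between the letters
  \<open>w ! j\<close> and \<open>w ! Suc j\<close> (positions counted from 0).
\<close>

type_synonym gpattern = "nat list \<times> bool list"

definition is_gpattern :: "gpattern \<Rightarrow> bool" where
  "is_gpattern \<tau> \<longleftrightarrow>
     distinct (fst \<tau>) \<and> set (fst \<tau>) = {1..length (fst \<tau>)} \<and>
     length (snd \<tau>) = length (fst \<tau>) - 1"

text \<open>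
  An occurrence is recorded as the list of its positions, which are elements of \<open>{1..n}\<close>.
\<close>

definition gpattern_occurrences :: "gpattern \<Rightarrow> nat \<Rightarrow> (nat \<Rightarrow> nat) \<Rightarrow> nat list set" where
  "gpattern_occurrences \<tau> n \<pi> =
     {is. length is = length (fst \<tau>) \<and> sorted_wrt (<) is \<and> set is \<subseteq> {1..n} \<and>
          (\<forall>a < length is. \<forall>b < length is.
             \<pi> (is ! a) < \<pi> (is ! b) \<longleftrightarrow> fst \<tau> ! a < fst \<tau> ! b) \<and>
          (\<forall>j. Suc j < length is \<longrightarrow> \<not> snd \<tau> ! j \<longrightarrow> is ! Suc j = is ! j + 1)}"

definition pattern_1_3_2 :: gpattern where
  "pattern_1_3_2 = ([1, 3, 2], [True, True])"

text \<open>The pattern \<open>12-3-\<cdots>-k\<close>, for \<open>k \<ge> 2\<close>: only the letters 1 and 2 are not separated by a dash.\<close>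

definition pattern_12_3_k :: "nat \<Rightarrow> gpattern" where
  "pattern_12_3_k k = ([1..<Suc k], False # replicate (k - 2) True)"

lemma is_gpattern_1_3_2: "is_gpattern pattern_1_3_2"
  by (auto simp: is_gpattern_def pattern_1_3_2_def)

lemma is_gpattern_12_3_k:
  assumes "k \<ge> 2"
  shows "is_gpattern (pattern_12_3_k k)"
  using assms by (auto simp: is_gpattern_def pattern_12_3_k_def)

definition phi :: "gpattern \<Rightarrow> nat \<Rightarrow> nat" where
  "phi \<tau> n =
     card {\<pi>. \<pi> permutes {1..n} \<and>
              card (gpattern_occurrences pattern_1_3_2 n \<pi>) = 1 \<and>
              card (gpattern_occurrences \<tau> n \<pi>) = 1}"

definition Phi :: "gpattern \<Rightarrow> real fps" where
  "Phi \<tau> = Abs_fps (\<lambda>n. of_nat (phi \<tau> n))"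


section \<open>Chebyshev polynomials of the second kind\<close>

definition chebyshev_U :: "nat \<Rightarrow> real poly" where
  "chebyshev_U p =
     (THE P. \<forall>\<theta>. sin \<theta> \<noteq> 0 \<longrightarrow> poly P (cos \<theta>) = sin ((real p + 1) * \<theta>) / sin \<theta>)"

text \<open>
  The description determines a unique polynomial, namely the one given by the usual recurrence.
\<close>

fun chebyshev_U_rec :: "nat \<Rightarrow> real poly" where
  "chebyshev_U_rec 0 = 1"
| "chebyshev_U_rec (Suc 0) = [:0, 2:]"
| "chebyshev_U_rec (Suc (Suc p)) = [:0, 2:] * chebyshev_U_rec (Suc p) - chebyshev_U_rec p"

lemma chebyshev_U_rec_cos:
  "poly (chebyshev_U_rec p) (cos \<theta>) * sin \<theta> = sin ((real p + 1) * \<theta>)"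
proof (induction p rule: chebyshev_U_rec.induct)
  case 1
  show ?case by simp
next
  case 2
  show ?case using sin_double[of \<theta>] by simp
next
  case (3 p)
  define a where "a = (real p + 2) * \<theta>"
  have e: "(real (Suc (Suc p)) + 1) * \<theta> = a + \<theta>" "(real (Suc p) + 1) * \<theta> = a"
    "(real p + 1) * \<theta> = a - \<theta>"
    by (simp_all add: a_def algebra_simps)
  have "poly (chebyshev_U_rec (Suc (Suc p))) (cos \<theta>) * sin \<theta> =
      2 * cos \<theta> * (poly (chebyshev_U_rec (Suc p)) (cos \<theta>) * sin \<theta>)
        - poly (chebyshev_U_rec p) (cos \<theta>) * sin \<theta>"
    by (simp add: algebra_simps)
  also have "\<dots> = 2 * cos \<theta> * sin a - sin (a - \<theta>)"
    using 3 by (simp only: e)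
  also have "\<dots> = sin (a + \<theta>)"
    by (simp add: sin_add sin_diff)
  finally show ?case by (simp only: e)
qed

lemma chebyshev_U_unique:
  fixes P Q :: "real poly"
  assumes P: "\<forall>\<theta>. sin \<theta> \<noteq> 0 \<longrightarrow> poly P (cos \<theta>) = sin ((real p + 1) * \<theta>) / sin \<theta>"
    and Q: "\<forall>\<theta>. sin \<theta> \<noteq> 0 \<longrightarrow> poly Q (cos \<theta>) = sin ((real p + 1) * \<theta>) / sin \<theta>"
  shows "P = Q"
proof (rule ccontr)
  assume "P \<noteq> Q"
  then have fin: "finite {x. poly (P - Q) x = 0}"
    by (intro poly_roots_finite) simp
  have "poly (P - Q) x = 0" if x: "x \<in> {-1<..<1}" for x
  proof -
    from x have c: "cos (arccos x) = x" by simp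
    have "sin (arccos x) \<noteq> 0"
      using x by (intro sin_arccos_nonzero) auto
    then have "poly P (cos (arccos x)) = poly Q (cos (arccos x))"
      using P Q by simp
    then show ?thesis by (simp add: c)
  qed
  then have "{-1<..<1} \<subseteq> {x. poly (P - Q) x = 0}" by blast
  with fin have "finite {-1<..<(1::real)}" by (rule rev_finite_subset)
  then show False using infinite_Ioo[of "-1" "1::real"] by simp
qed

lemma chebyshev_U_eq_rec: "chebyshev_U p = chebyshev_U_rec p"
  unfolding chebyshev_U_def
proof (rule the_equality)
  show *: "\<forall>\<theta>. sin \<theta> \<noteq> 0 \<longrightarrow>
      poly (chebyshev_U_rec p) (cos \<theta>) = sin ((real p + 1) * \<theta>) / sin \<theta>"
    by (simp add: chebyshev_U_rec_cos[symmetric])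
  show "P = chebyshev_U_rec p"
    if "\<forall>\<theta>. sin \<theta> \<noteq> 0 \<longrightarrow> poly P (cos \<theta>) = sin ((real p + 1) * \<theta>) / sin \<theta>" for P
    using chebyshev_U_unique[OF that *] .
qed

lemma chebyshev_U_cos:
  "sin \<theta> \<noteq> 0 \<Longrightarrow> poly (chebyshev_U p) (cos \<theta>) = sin ((real p + 1) * \<theta>) / sin \<theta>"
  by (simp add: chebyshev_U_eq_rec chebyshev_U_rec_cos[symmetric])

definition chebyshev_U_at :: "nat \<Rightarrow> real fls \<Rightarrow> real fls" where
  "chebyshev_U_at p t = poly (map_poly fls_const (chebyshev_U p)) t"

text \<open>
  Identities involving \<open>\<surd>x\<close> are read in the field of formal Laurent series in an indeterminate
  \<open>s = \<surd>x\<close>. A power series in \<open>x\<close> is mapped into it by the substitution \<open>x = s\<^sup>2\<close>.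
\<close>

definition sqrt_x :: "real fls" where
  "sqrt_x = fls_X"

definition in_sqrt_x :: "real fps \<Rightarrow> real fls" where
  "in_sqrt_x F = fps_to_fls (F oo fps_X ^ 2)"

end

theory Submission
  imports Defs "HOL-Library.Sublist"
begin

text \<open>
  Split a permutation of \<open>{1..n}\<close> at its maximum, \<open>\<pi> = u n v\<close>. If it has at most one
  occurrence of 1-3-2, there are two possibilities. Either every letter of \<open>u\<close> exceeds every letter of \<open>v\<close>, and the
  occurrences of 1-3-2 are those of \<open>u\<close> and those of \<open>v\<close>; or \<open>n\<close> takes part in the occurrence
  \<open>a n b\<close>, and then \<open>a\<close> is the last letter of \<open>u\<close>, \<open>b = a + 1\<close> is the largest letter of \<open>v\<close>, the
  remaining letters of \<open>v\<close> and \<open>u\<close> lie below \<open>a\<close> and above \<open>b\<close>, and both parts avoid 1-3-2. In both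
  cases the number \<open>c\<^sub>k\<close> of occurrences of 12-3-\<open>\<cdots>\<close>-\<open>k\<close> satisfies
  \<open>c\<^sub>k(\<pi>) = c\<^sub>k(u) + c\<^sub>k(v) + c\<^sub>k\<^sub>-\<^sub>1(u)\<close>, where \<open>c\<^sub>1\<close> is 1 on nonempty words. Moreover
  \<open>c\<^sub>k > 0\<close> forces \<open>c\<^sub>k\<^sub>-\<^sub>1 \<ge> 2\<close> for \<open>k \<ge> 3\<close>. This yields linear recurrences for the generating functions
  of the permutations with 0 or 1 occurrences of each of the two patterns. They are solved in terms
  of \<open>R\<^sub>p(x) = x\<^bsup>p/2\<^esup> U\<^sub>p(1/(2\<surd>x))\<close>, using \<open>R\<^sub>p\<^sub>+\<^sub>1\<^sup>2 - R\<^sub>p R\<^sub>p\<^sub>+\<^sub>2 = x\<^bsup>p+1\<^esup>\<close>.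
\<close>

section \<open>Counting occurrences in words\<close>

text \<open>\<open>inc_above j x ys\<close> counts the increasing subsequences of length \<open>j\<close> with all letters above \<open>x\<close>.\<close>

fun inc_above :: "nat \<Rightarrow> nat \<Rightarrow> nat list \<Rightarrow> nat" where
  "inc_above 0 x ys = 1"
| "inc_above (Suc j) x [] = 0"
| "inc_above (Suc j) x (y # ys) =
     inc_above (Suc j) x ys + (if x < y then inc_above j y ys else 0)"

text \<open>
  For \<open>j \<ge> 1\<close>, \<open>occ12 j w\<close> counts the occurrences of 12-3-\<open>\<cdots>\<close>-\<open>(j + 1)\<close> in \<open>w\<close>. The value for
  \<open>j = 0\<close> is chosen so that the recurrence for \<open>occ12 1\<close> has the same form as the others.
\<close>

fun occ12 :: "nat \<Rightarrow> nat list \<Rightarrow> nat" where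
  "occ12 0 w = (if w = [] then 0 else 1)"
| "occ12 (Suc j) [] = 0"
| "occ12 (Suc j) [x] = 0"
| "occ12 (Suc j) (x # y # ys) = occ12 (Suc j) (y # ys) + (if x < y then inc_above j y ys else 0)"

lemma occ12_Nil [simp]: "occ12 j [] = 0"
  by (cases j) auto

lemma inc_above_eq_0: "\<forall>z\<in>set v. z \<le> x \<Longrightarrow> inc_above (Suc j) x v = 0"
  by (induction v) auto

lemma inc_above_append_smaller:
  assumes "\<forall>z\<in>set v. z \<le> x"
  shows "inc_above j x (u @ v) = inc_above j x u"
  using assms
proof (induction u arbitrary: x j)
  case Nil
  then show ?case by (cases j) (auto simp: inc_above_eq_0)
next
  case (Cons y u)
  show ?case
  proof (cases j)
    case (Suc i)
    have "\<forall>z\<in>set v. z \<le> y" if "x < y" using Cons.prems that by fastforce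
    then show ?thesis using Cons Suc by auto
  qed auto
qed

text \<open>No letter of \<open>v\<close> can be used, and \<open>m\<close> can only come last;
  deleting it leaves an increasing subsequence of \<open>u\<close> that is shorter by one.\<close>

lemma inc_above_append_max:
  assumes "\<forall>z\<in>set v. z \<le> x" "\<forall>y\<in>set u. y < m" "x < m"
  shows "inc_above (Suc j) x (u @ m # v) = inc_above (Suc j) x u + inc_above j x u"
  using assms
proof (induction u arbitrary: x j)
  case Nil
  then have "\<forall>z\<in>set v. z \<le> m" by force
  then show ?case using Nil by (cases j) (auto simp: inc_above_eq_0)
next
  case (Cons y u)
  have 1: "\<forall>z\<in>set v. z \<le> y" if "x < y" using Cons.prems that by fastforce
  show ?case
    using Cons.IH[of x j] Cons.IH[OF 1, of "j - 1"] Cons.prems by (cases j) auto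
qed

lemma inc_above_map:
  assumes "strict_mono_on A f" "set ys \<subseteq> A" "x \<in> A"
  shows "inc_above j (f x) (map f ys) = inc_above j x ys"
  using assms(2,3)
proof (induction ys arbitrary: x j)
  case Nil
  show ?case by (cases j) auto
next
  case (Cons y ys)
  have "f x < f y \<longleftrightarrow> x < y"
    using Cons.prems strict_mono_on_less[OF assms(1), of x y] by simp
  then show ?case using Cons by (cases j) auto
qed

lemma inc_above_antimono: "x \<le> y \<Longrightarrow> inc_above j y ys \<le> inc_above j x ys"
proof (induction ys)
  case Nil
  show ?case by (cases j) auto
next
  case (Cons z ys)
  then show ?case by (cases j) auto
qed

text \<open>Deleting the first or the last letter of an increasing subsequence of length
  \<open>j + 2\<close> leaves two different ones of length \<open>j + 1\<close>.\<close>

lemma inc_above_ge_2: "inc_above (Suc (Suc j)) x ys > 0 \<Longrightarrow> inc_above (Suc j) x ys \<ge> 2"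
proof (induction ys arbitrary: x j)
  case (Cons y ys)
  consider "inc_above (Suc (Suc j)) x ys > 0" | "x < y" "inc_above (Suc j) y ys > 0"
    using Cons.prems by (auto split: if_splits)
  then show ?case
  proof cases
    case 1
    then show ?thesis using Cons.IH[OF 1] by simp
  next
    case 2
    show ?thesis
    proof (cases j)
      case 0
      then show ?thesis using 2 inc_above_antimono[of x y 1 ys] by auto
    next
      case (Suc i)
      then show ?thesis using 2 Cons.IH[of i y] by simp
    qed
  qed
qed auto

text \<open>An occurrence ending in \<open>m\<close> loses its last letter and becomes one of the
  shorter pattern in \<open>u\<close>; for \<open>j = 0\<close> the last letter of \<open>u\<close>
  and \<open>m\<close> form an ascent as soon as \<open>u\<close> is nonempty. All other occurrences
  lie in \<open>u\<close> or in \<open>v\<close>: an ascent inside \<open>u\<close> starts in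
  \<open>butlast u\<close>, so its top exceeds all of \<open>v\<close>. The last letter of
  \<open>u\<close> is exempt because in \<open>glue132\<close> it is smaller than a letter of
  \<open>v\<close>.\<close>

lemma occ12_append_max:
  assumes "\<forall>x\<in>set (butlast u). \<forall>z\<in>set v. z \<le> x" "\<forall>y\<in>set u \<union> set v. y < m"
  shows "occ12 (Suc j) (u @ m # v) = occ12 (Suc j) u + occ12 (Suc j) v + occ12 j u"
  using assms
proof (induction u rule: induct_list012)
  case 1
  then show ?case by (cases v) auto
next
  case (2 x)
  have "occ12 (Suc j) (m # v) = occ12 (Suc j) v" using 2 by (cases v) auto
  \<comment> \<open>With \<open>m\<close> as top of the ascent nothing later is larger, so only the
    pattern 12 itself is completed.\<close>
  moreover have "inc_above j m v = (if j = 0 then 1 else 0)"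
    using 2 by (cases j) (auto intro!: inc_above_eq_0)
  ultimately show ?case using 2 by (cases j) auto
next
  case (3 x y u)
  have IH: "occ12 (Suc j) ((y # u) @ m # v)
      = occ12 (Suc j) (y # u) + occ12 (Suc j) v + occ12 j (y # u)"
    using 3 by (intro "3.IH") auto
  show ?case
  proof (cases j)
    case 0
    have "inc_above 0 y (u @ m # v) = 1" by simp
    then show ?thesis using IH 0 by auto
  next
    case (Suc i)
    have "inc_above (Suc i) y (u @ m # v) = inc_above (Suc i) y u + inc_above i y u" if "x < y"
      using "3.prems" that by (intro inc_above_append_max) fastforce+
    then show ?thesis using IH Suc by auto
  qed
qed

text \<open>The smallest letter, placed last, can be neither the top of an ascent nor a later letter
  of an occurrence.\<close>

lemma occ12_append_min:
  assumes "\<forall>x\<in>set u. a < x"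
  shows "occ12 (Suc j) (u @ [a]) = occ12 (Suc j) u"
  using assms
proof (induction u rule: induct_list012)
  case (3 x y u)
  have "inc_above j y (u @ [a]) = inc_above j y u"
    using 3 by (intro inc_above_append_smaller) auto
  then show ?case using 3 by auto
qed auto

lemma occ12_map:
  assumes "strict_mono_on A f" "set w \<subseteq> A"
  shows "occ12 j (map f w) = occ12 j w"
  using assms(2)
proof (induction w rule: induct_list012)
  case (3 x y w)
  have "f x < f y \<longleftrightarrow> x < y"
    using 3 strict_mono_on_less[OF assms(1), of x y] by simp
  then show ?case using 3 inc_above_map[OF assms(1), of w y "j - 1"] by (cases j) auto
qed (cases j; simp)+

text \<open>On the way from \<open>y\<close> up to a larger letter some adjacent pair must rise.
  This supplies the second ascent for \<open>j = 0\<close> in \<open>occ12_ge_2\<close>.\<close>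

lemma occ12_1_pos: "inc_above (Suc 0) y ys > 0 \<Longrightarrow> occ12 (Suc 0) (y # ys) > 0"
proof (induction ys arbitrary: y)
  case (Cons z ys)
  show ?case
  proof (cases "y < z")
    case False
    then have "inc_above (Suc 0) y ys > 0" using Cons.prems by simp
    then have "inc_above (Suc 0) z ys > 0" using inc_above_antimono[of z y 1 ys] False by simp
    then show ?thesis using Cons.IH by simp
  qed simp
qed simp

text \<open>Dropping the last letter of an occurrence leaves one of the shorter pattern. For
  \<open>j > 0\<close> dropping the third letter gives another with the same ascent; for
  \<open>j = 0\<close>, the pattern 12-3, a second ascent lies on the way from the 2 to the
  3.\<close>

lemma occ12_ge_2: "occ12 (Suc (Suc j)) w > 0 \<Longrightarrow> occ12 (Suc j) w \<ge> 2"
proof (induction w rule: induct_list012)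
  case (3 x y w)
  consider "occ12 (Suc (Suc j)) (y # w) > 0" | "x < y" "inc_above (Suc j) y w > 0"
    using "3.prems" by (auto split: if_splits)
  then show ?case
  proof cases
    case 1
    then show ?thesis using "3.IH" by simp
  next
    case 2
    show ?thesis
    proof (cases j)
      case 0
      then show ?thesis using 2 occ12_1_pos[of y w] by simp
    next
      case (Suc i)
      then show ?thesis using 2 inc_above_ge_2[of i y w] by simp
    qed
  qed
qed auto

lemma occ12_eq_0_Suc: "occ12 j w = 0 \<Longrightarrow> occ12 (Suc j) w = 0"
  using occ12_ge_2[of "j - 1" w] by (cases j) (auto split: if_splits)

lemma occ12_eq_1_Suc: "occ12 (Suc j) w = 1 \<Longrightarrow> occ12 (Suc (Suc j)) w = 0"
  using occ12_ge_2[of j w] by auto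

section \<open>From permutations to words\<close>

text \<open>Position lists behind the count \<open>inc_above\<close>; the lower bound
  \<open>m\<close> permits induction from the right end of the word.\<close>

definition inc_positions :: "(nat \<Rightarrow> nat) \<Rightarrow> nat \<Rightarrow> nat \<Rightarrow> nat \<Rightarrow> nat \<Rightarrow> nat list set" where
  "inc_positions \<pi> n j x m =
     {is. length is = j \<and> sorted_wrt (<) is \<and> set is \<subseteq> {m..n} \<and>
          (\<forall>i\<in>set is. x < \<pi> i) \<and> sorted_wrt (\<lambda>a b. \<pi> a < \<pi> b) is}"

lemma finite_inc_positions [simp]: "finite (inc_positions \<pi> n j x m)"
  by (rule finite_subset[OF _ finite_lists_length_eq[of "{m..n}" j]])
    (auto simp: inc_positions_def)

lemma inc_positions_Suc:
  assumes "m \<le> n"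
  shows "inc_positions \<pi> n (Suc j) x m = inc_positions \<pi> n (Suc j) x (Suc m) \<union>
    (if x < \<pi> m then (#) m ` inc_positions \<pi> n j (\<pi> m) (Suc m) else {})" (is "?L = ?R")
proof
  show "?L \<subseteq> ?R"
  proof
    fix js assume js: "js \<in> ?L"
    then obtain i ks where [simp]: "js = i # ks" by (cases js) (auto simp: inc_positions_def)
    show "js \<in> ?R"
    proof (cases "i = m")
      case True
      then show ?thesis using js by (fastforce simp: inc_positions_def image_iff)
    next
      case False
      then show ?thesis using js by (fastforce simp: inc_positions_def)
    qed
  qed
  show "?R \<subseteq> ?L"
    using assms
    by (auto simp: inc_positions_def subset_iff Suc_le_eq intro: order.strict_trans split: if_splits)
qed

lemma card_inc_positions:
  "card (inc_positions \<pi> n j x m) = inc_above j x (map \<pi> [m..<Suc n])"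
proof (induction "Suc n - m" arbitrary: m j x)
  case 0
  have "inc_positions \<pi> n j x m = (if j = 0 then {[]} else {})"
    using 0 by (auto simp: inc_positions_def)
  then show ?case using 0 by (cases j) auto
next
  case (Suc l)
  show ?case
  proof (cases j)
    case 0
    have "inc_positions \<pi> n 0 x m = {[]}" by (auto simp: inc_positions_def)
    then show ?thesis using 0 by auto
  next
    case (Suc i)
    have m: "m \<le> n" "l = Suc n - Suc m" using Suc.hyps(2) by auto
    have "inc_positions \<pi> n (Suc i) x (Suc m) \<inter> (#) m ` inc_positions \<pi> n i (\<pi> m) (Suc m) = {}"
      by (auto simp: inc_positions_def)
    then have "card (inc_positions \<pi> n (Suc i) x m) = card (inc_positions \<pi> n (Suc i) x (Suc m))
        + (if x < \<pi> m then card (inc_positions \<pi> n i (\<pi> m) (Suc m)) else 0)"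
      using m by (simp add: inc_positions_Suc card_Un_disjoint card_image)
    then show ?thesis
      using m Suc.hyps(1)[OF m(2)] by (simp add: Suc upt_conv_Cons del: upt_Suc)
  qed
qed

definition asc_positions :: "(nat \<Rightarrow> nat) \<Rightarrow> nat \<Rightarrow> nat \<Rightarrow> nat \<Rightarrow> nat list set" where
  "asc_positions \<pi> n j m =
     {p # Suc p # is | p is. m \<le> p \<and> Suc p \<le> n \<and> \<pi> p < \<pi> (Suc p) \<and>
        is \<in> inc_positions \<pi> n j (\<pi> (Suc p)) (Suc (Suc p))}"

lemma asc_positions_Suc:
  "asc_positions \<pi> n j m = asc_positions \<pi> n j (Suc m) \<union>
    (if m < n \<and> \<pi> m < \<pi> (Suc m)
     then (\<lambda>is. m # Suc m # is) ` inc_positions \<pi> n j (\<pi> (Suc m)) (Suc (Suc m)) else {})"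
  unfolding asc_positions_def by (auto simp: not_less_eq_eq le_less_Suc_eq dest: le_antisym)

lemma card_asc_positions:
  "finite (asc_positions \<pi> n j m) \<and>
   card (asc_positions \<pi> n j m) = occ12 (Suc j) (map \<pi> [m..<Suc n])"
proof (induction "Suc n - m" arbitrary: m)
  case 0
  have "asc_positions \<pi> n j m = {}"
    using 0 by (auto simp: asc_positions_def)
  then show ?case using 0 by auto
next
  case (Suc l)
  have m: "m \<le> n" "l = Suc n - Suc m" using Suc.hyps(2) by auto
  let ?I = "inc_positions \<pi> n j (\<pi> (Suc m)) (Suc (Suc m))"
  have disj: "asc_positions \<pi> n j (Suc m) \<inter> (\<lambda>is. m # Suc m # is) ` ?I = {}"
    by (auto simp: asc_positions_def)
  have inj: "inj_on (\<lambda>is. m # Suc m # is) ?I" by (auto simp: inj_on_def)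
  have "card (asc_positions \<pi> n j m) = card (asc_positions \<pi> n j (Suc m)) +
      (if m < n \<and> \<pi> m < \<pi> (Suc m) then card ?I else 0)"
    using disj inj Suc.hyps(1)[OF m(2)]
    by (subst asc_positions_Suc) (simp add: card_Un_disjoint card_image)
  moreover have "finite (asc_positions \<pi> n j m)"
    using Suc.hyps(1)[OF m(2)] by (subst asc_positions_Suc) simp
  moreover have "occ12 (Suc j) (map \<pi> [m..<Suc n]) = occ12 (Suc j) (map \<pi> [Suc m..<Suc n]) +
      (if m < n \<and> \<pi> m < \<pi> (Suc m)
       then inc_above j (\<pi> (Suc m)) (map \<pi> [Suc (Suc m)..<Suc n]) else 0)"
    using m(1) by (cases "m = n") (simp_all add: upt_conv_Cons del: upt_Suc)
  ultimately show ?case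
    using Suc.hyps(1)[OF m(2)] by (simp add: card_inc_positions del: upt_Suc)
qed

lemma gpattern_occurrences_12_3_k:
  "gpattern_occurrences (pattern_12_3_k (Suc (Suc j))) n \<pi> = asc_positions \<pi> n j 1"
    (is "?L = ?R")
proof -
  have nth: "[Suc 0..<Suc k] ! a = Suc a" if "a < k" for a k
    using that by (simp del: upt_Suc)
  \<comment> \<open>The letters of the pattern increase, so order-isomorphism says that
    \<open>\<pi>\<close> increases along the positions.\<close>
  have mono: "(\<forall>a<length is. \<forall>b<length is. \<pi> (is ! a) < \<pi> (is ! b) \<longleftrightarrow> a < b)
      \<longleftrightarrow> sorted_wrt (\<lambda>a b. \<pi> a < \<pi> b) is" for "is"
  proof
    assume s: "sorted_wrt (\<lambda>a b. \<pi> a < \<pi> b) is"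
    show "\<forall>a<length is. \<forall>b<length is. \<pi> (is ! a) < \<pi> (is ! b) \<longleftrightarrow> a < b"
    proof (intro allI impI)
      fix a b assume "a < length is" "b < length is"
      then show "\<pi> (is ! a) < \<pi> (is ! b) \<longleftrightarrow> a < b"
        using sorted_wrt_nth_less[OF s, of a b] sorted_wrt_nth_less[OF s, of b a]
        by (cases a b rule: linorder_cases) auto
    qed
  qed (auto simp: sorted_wrt_iff_nth_less)
  \<comment> \<open>Only the first gap carries no dash, so adjacency concerns the first two
    positions alone.\<close>
  have dash: "(\<forall>i. Suc i < length is \<longrightarrow> \<not> (False # replicate j True) ! i \<longrightarrow> is ! Suc i = is ! i + 1)
      \<longleftrightarrow> is ! 1 = is ! 0 + 1" if "length is = Suc (Suc j)" for "is" :: "nat list"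
  proof -
    have "(False # replicate j True) ! i \<longleftrightarrow> i \<noteq> 0" if "i < Suc j" for i
      using that by (cases i) auto
    then show ?thesis using that by auto
  qed
  have "?L = {is. length is = Suc (Suc j) \<and> sorted_wrt (<) is \<and> set is \<subseteq> {1..n} \<and>
      sorted_wrt (\<lambda>a b. \<pi> a < \<pi> b) is \<and> is ! 1 = is ! 0 + 1}"
    unfolding gpattern_occurrences_def
  proof (rule Collect_cong, goal_cases)
    case (1 xs)
    show ?case
    proof (cases "length xs = Suc (Suc j)")
      case True
      show ?thesis
        unfolding mono[symmetric] dash[OF True, symmetric]
        using True by (simp add: pattern_12_3_k_def nth del: upt_Suc)
    qed (simp add: pattern_12_3_k_def)
  qed
  also have "\<dots> = ?R"
  proof (rule set_eqI)
    fix xs :: "nat list"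
    show "xs \<in> {is. length is = Suc (Suc j) \<and> sorted_wrt (<) is \<and> set is \<subseteq> {1..n} \<and>
      sorted_wrt (\<lambda>a b. \<pi> a < \<pi> b) is \<and> is ! 1 = is ! 0 + 1} \<longleftrightarrow> xs \<in> ?R"
    proof (cases "\<exists>p q is. xs = p # q # is")
      case True
      then obtain p q "is" where [simp]: "xs = p # q # is" by blast
      show ?thesis
        by (auto simp: asc_positions_def inc_positions_def Suc_le_eq intro: order.strict_trans)
    next
      case False
      then have "length xs \<noteq> Suc (Suc j)" by (auto simp: length_Suc_conv)
      then show ?thesis using False by (auto simp: asc_positions_def)
    qed
  qed
  finally show ?thesis .
qed

lemma card_gpattern_occurrences_12_3_k:
  "card (gpattern_occurrences (pattern_12_3_k (Suc (Suc j))) n \<pi>) =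
   occ12 (Suc j) (map \<pi> [1..<Suc n])"
  by (simp only: gpattern_occurrences_12_3_k card_asc_positions)

text \<open>Occurrences of 1-3-2 are recorded by their letters, which is harmless for words without repetition.\<close>

definition occ132 :: "nat list \<Rightarrow> (nat \<times> nat \<times> nat) set" where
  "occ132 w = {(x, y, z). subseq [x, y, z] w \<and> x < z \<and> z < y}"

lemma subseq_map_iff: "subseq v (map f xs) \<longleftrightarrow> (\<exists>u. subseq u xs \<and> v = map f u)"
  by (metis subseq_conv_nths nths_map)

lemma subseq_upt_iff: "subseq is [m..<n] \<longleftrightarrow> sorted_wrt (<) is \<and> set is \<subseteq> {m..<n}"
proof
  assume s: "subseq is [m..<n]"
  then obtain N where N: "is = nths [m..<n] N" by (auto simp: subseq_conv_nths)
  have "sorted is" unfolding N by (intro sorted_nths) simp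
  moreover have "distinct is" unfolding N by (intro distinct_nthsI) simp
  ultimately show "sorted_wrt (<) is \<and> set is \<subseteq> {m..<n}"
    using set_nths_subset[of "[m..<n]" N] N by (simp add: strict_sorted_iff)
next
  assume "sorted_wrt (<) is \<and> set is \<subseteq> {m..<n}"
  then show "subseq is [m..<n]" by (intro sorted_subset_imp_subseq) auto
qed

text \<open>Both sets are images of one set \<open>T\<close> of position triples under injective
  maps; for the letter triples this uses injectivity of \<open>\<pi>\<close>.\<close>

lemma card_gpattern_occurrences_1_3_2:
  assumes "inj_on \<pi> {1..n}"
  shows "card (gpattern_occurrences pattern_1_3_2 n \<pi>) = card (occ132 (map \<pi> [1..<Suc n]))"
proof -
  define T where "T = {(a, b, c). 1 \<le> a \<and> a < b \<and> b < c \<and> c \<le> n \<and> \<pi> a < \<pi> c \<and> \<pi> c < \<pi> b}"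
  have "gpattern_occurrences pattern_1_3_2 n \<pi> = (\<lambda>(a, b, c). [a, b, c]) ` T" (is "?L = ?R")
  proof (rule set_eqI)
    fix xs :: "nat list"
    show "xs \<in> ?L \<longleftrightarrow> xs \<in> ?R"
    proof (cases "length xs = 3")
      case True
      then obtain a b c where [simp]: "xs = [a, b, c]"
        by (auto simp: length_Suc_conv numeral_3_eq_3)
      show ?thesis
        by (auto simp: gpattern_occurrences_def pattern_1_3_2_def T_def image_iff
            All_less_Suc numeral_3_eq_3)
    next
      case False
      then show ?thesis by (auto simp: gpattern_occurrences_def pattern_1_3_2_def)
    qed
  qed
  moreover have "inj_on (\<lambda>(a, b, c). [a, b, c]) T" by (auto simp: inj_on_def)
  moreover have "occ132 (map \<pi> [1..<Suc n]) = (\<lambda>(a, b, c). (\<pi> a, \<pi> b, \<pi> c)) ` T"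
  proof -
    have "subseq [x, y, z] (map \<pi> [1..<Suc n]) \<longleftrightarrow>
        (\<exists>a b c. 1 \<le> a \<and> a < b \<and> b < c \<and> c \<le> n \<and> x = \<pi> a \<and> y = \<pi> b \<and> z = \<pi> c)" for x y z
    proof -
      have "subseq [x, y, z] (map \<pi> [1..<Suc n]) \<longleftrightarrow>
        (\<exists>is. sorted_wrt (<) is \<and> set is \<subseteq> {1..n} \<and> [x, y, z] = map \<pi> is)"
        unfolding subseq_map_iff subseq_upt_iff by (simp add: atLeastLessThanSuc_atLeastAtMost)
      also have "\<dots> \<longleftrightarrow>
        (\<exists>a b c. 1 \<le> a \<and> a < b \<and> b < c \<and> c \<le> n \<and> x = \<pi> a \<and> y = \<pi> b \<and> z = \<pi> c)" (is "_ \<longleftrightarrow> ?E")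
      proof
        assume ?E
        then obtain a b c where "1 \<le> a \<and> a < b \<and> b < c \<and> c \<le> n \<and> x = \<pi> a \<and> y = \<pi> b \<and> z = \<pi> c"
          by blast
        then show "\<exists>is. sorted_wrt (<) is \<and> set is \<subseteq> {1..n} \<and> [x, y, z] = map \<pi> is"
          by (intro exI[of _ "[a, b, c]"]) auto
      next
        assume "\<exists>is. sorted_wrt (<) is \<and> set is \<subseteq> {1..n} \<and> [x, y, z] = map \<pi> is"
        then obtain a b c where "sorted_wrt (<) [a, b, c]" "set [a, b, c] \<subseteq> {1..n}"
          "x = \<pi> a" "y = \<pi> b" "z = \<pi> c"
          by (auto simp: Cons_eq_map_conv)
        then show ?E by (intro exI[of _ a] exI[of _ b] exI[of _ c]) auto
      qed
      finally show ?thesis .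
    qed
    then show ?thesis by (fastforce simp: occ132_def T_def image_iff)
  qed
  moreover have "inj_on (\<lambda>(a, b, c). (\<pi> a, \<pi> b, \<pi> c)) T"
  proof -
    have "T \<subseteq> {1..n} \<times> {1..n} \<times> {1..n}" by (auto simp: T_def)
    moreover have "inj_on (map_prod \<pi> (map_prod \<pi> \<pi>)) ({1..n} \<times> {1..n} \<times> {1..n})"
      using assms by (intro map_prod_inj_on)
    moreover have "map_prod \<pi> (map_prod \<pi> \<pi>) = (\<lambda>(a, b, c). (\<pi> a, \<pi> b, \<pi> c))"
      by auto
    ultimately show ?thesis using inj_on_subset by metis
  qed
  ultimately show ?thesis by (simp add: card_image)
qed

section \<open>Permutations written as words\<close>

definition perm_words :: "nat list set" where
  "perm_words = {w. distinct w \<and> set w = {1..length w}}"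

lemma bij_betw_permutes_perm_words:
  "bij_betw (\<lambda>\<pi>. map \<pi> [1..<Suc n]) {\<pi>. \<pi> permutes {1..n}} {w \<in> perm_words. length w = n}"
\<comment> \<open>The inverse must fix every point outside \<open>{1..n}\<close>, as
  \<open>permutes\<close> demands; positions start at 1 and list indices at 0.\<close>
proof (rule bij_betw_byWitness[where f' = "\<lambda>w i. if i \<in> {1..n} then w ! (i - 1) else i"])
  show "\<forall>\<pi>\<in>{\<pi>. \<pi> permutes {1..n}}.
      (\<lambda>i. if i \<in> {1..n} then map \<pi> [1..<Suc n] ! (i - 1) else i) = \<pi>"
    by (auto simp: permutes_def fun_eq_iff simp del: upt_Suc)
  show "\<forall>w\<in>{w \<in> perm_words. length w = n}.
      map (\<lambda>i. if i \<in> {1..n} then w ! (i - 1) else i) [1..<Suc n] = w"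
    by (auto intro!: nth_equalityI simp del: upt_Suc)
  show "(\<lambda>\<pi>. map \<pi> [1..<Suc n]) ` {\<pi>. \<pi> permutes {1..n}} \<subseteq> {w \<in> perm_words. length w = n}"
    by (auto simp: perm_words_def distinct_map atLeastLessThanSuc_atLeastAtMost permutes_inj_on
        permutes_image simp del: upt_Suc)
  show "(\<lambda>w i. if i \<in> {1..n} then w ! (i - 1) else i) ` {w \<in> perm_words. length w = n}
      \<subseteq> {\<pi>. \<pi> permutes {1..n}}"
  proof clarify
    fix w assume w: "w \<in> perm_words" and [simp]: "n = length w"
    have "bij_betw (\<lambda>i. i - 1) {1..length w} {..<length w}"
      by (rule bij_betw_byWitness[where f' = Suc]) auto
    moreover have "bij_betw ((!) w) {..<length w} {1..length w}"
      using w by (intro bij_betw_nth) (auto simp: perm_words_def)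
    ultimately have "bij_betw ((!) w \<circ> (\<lambda>i. i - 1)) {1..length w} {1..length w}"
      by (rule bij_betw_trans)
    then have "bij_betw (\<lambda>i. if i \<in> {1..length w} then w ! (i - 1) else i) {1..length w} {1..length w}"
      by (rule bij_betw_cong[THEN iffD1, rotated]) auto
    then show "(\<lambda>i. if i \<in> {1..length w} then w ! (i - 1) else i) permutes {1..length w}"
      by (rule bij_imp_permutes) auto
  qed
qed

lemma phi_eq_card_perm_words:
  "phi (pattern_12_3_k (Suc (Suc j))) n =
   card {w \<in> perm_words. length w = n \<and> card (occ132 w) = 1 \<and> occ12 (Suc j) w = 1}"
proof -
  let ?f = "\<lambda>\<pi>. map \<pi> [1..<Suc n]"
  let ?S = "{\<pi>. \<pi> permutes {1..n} \<and> card (occ132 (?f \<pi>)) = 1 \<and> occ12 (Suc j) (?f \<pi>) = 1}"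
  have "phi (pattern_12_3_k (Suc (Suc j))) n = card ?S"
    unfolding phi_def
    by (intro arg_cong[where f = card] Collect_cong conj_cong refl)
      (simp_all add: card_gpattern_occurrences_1_3_2 card_gpattern_occurrences_12_3_k
        permutes_inj_on del: upt_Suc)
  also have "\<dots> = card (?f ` ?S)"
    using bij_betw_permutes_perm_words[of n]
    by (intro card_image[symmetric]) (auto simp: bij_betw_def inj_on_def simp del: upt_Suc)
  also have "?f ` ?S =
      {w \<in> perm_words. length w = n \<and> card (occ132 w) = 1 \<and> occ12 (Suc j) w = 1}"
  proof -
    have "?f ` ?S = {w \<in> ?f ` {\<pi>. \<pi> permutes {1..n}}. card (occ132 w) = 1 \<and> occ12 (Suc j) w = 1}"
      by blast
    then show ?thesis
      unfolding bij_betw_imp_surj_on[OF bij_betw_permutes_perm_words[of n]] by auto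
  qed
  finally show ?thesis .
qed

section \<open>Words with at most one occurrence of 1-3-2\<close>

lemma subseq_2_append_iff:
  "subseq [x, y] (u @ v) \<longleftrightarrow> subseq [x, y] u \<or> x \<in> set u \<and> y \<in> set v \<or> subseq [x, y] v"
    (is "?L \<longleftrightarrow> ?R")
proof
  assume ?L
  then show ?R by (auto simp: subseq_append_iff Cons_eq_append_conv subseq_singleton_left)
next
  assume ?R
  then show ?L
    using list_emb_append_mono[of "(=)" "[x]" u "[y]" v]
    by (auto simp: subseq_singleton_left intro: subseq_drop_many subseq_rev_drop_many)
qed

lemma subseq_3_append_iff:
  "subseq [x, y, z] (u @ v) \<longleftrightarrow> subseq [x, y, z] u \<or> subseq [x, y] u \<and> z \<in> set v \<or>
     x \<in> set u \<and> subseq [y, z] v \<or> subseq [x, y, z] v" (is "?L \<longleftrightarrow> ?R")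
proof
  assume ?L
  then show ?R by (auto simp: subseq_append_iff Cons_eq_append_conv subseq_singleton_left)
next
  assume ?R
  then show ?L
    using list_emb_append_mono[of "(=)" "[x]" u "[y, z]" v]
      list_emb_append_mono[of "(=)" "[x, y]" u "[z]" v]
    by (auto simp: subseq_singleton_left intro: subseq_drop_many subseq_rev_drop_many)
qed

lemma subseq_imp_set_subset: "subseq xs ys \<Longrightarrow> set xs \<subseteq> set ys"
  by (metis subseq_conv_nths set_nths_subset)

lemma occ132_subset: "occ132 w \<subseteq> set w \<times> set w \<times> set w"
  unfolding occ132_def using subseq_imp_set_subset by fastforce

lemma finite_occ132 [simp]: "finite (occ132 w)"
  by (rule finite_subset[OF occ132_subset]) simp

lemma occ132_Nil [simp]: "occ132 [] = {}"
  by (auto simp: occ132_def)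

lemma subseq_2_Cons_iff:
  "subseq [x, y] (m # v) \<longleftrightarrow> x = m \<and> y \<in> set v \<or> subseq [x, y] v"
  using subseq_2_append_iff[of x y "[m]" v] by auto

lemma subseq_3_Cons_iff:
  "subseq [x, y, z] (m # v) \<longleftrightarrow> x = m \<and> subseq [y, z] v \<or> subseq [x, y, z] v"
  using subseq_3_append_iff[of x y z "[m]" v] by auto

lemma card_occ132_map:
  assumes "strict_mono_on A f" "set w \<subseteq> A"
  shows "card (occ132 (map f w)) = card (occ132 w)"
proof -
  let ?F = "\<lambda>(x, y, z). (f x, f y, f z)"
  have inj: "inj_on f (set w)"
    using assms strict_mono_on_imp_inj_on inj_on_subset by blast
  have less: "f x < f y \<longleftrightarrow> x < y" if "x \<in> set w" "y \<in> set w" for x y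
    using that assms(2) strict_mono_on_less[OF assms(1), of x y] by auto
  have "occ132 (map f w) = ?F ` occ132 w"
  proof (intro set_eqI iffI)
    fix t assume "t \<in> occ132 (map f w)"
    then obtain x y z where t: "t = (f x, f y, f z)" "subseq [x, y, z] w" "f x < f z" "f z < f y"
      by (auto simp: occ132_def subseq_map_iff Cons_eq_map_conv)
    then have "(x, y, z) \<in> occ132 w"
      using subseq_imp_set_subset[OF t(2)] less by (auto simp: occ132_def)
    then show "t \<in> ?F ` occ132 w" using t(1) by force
  next
    fix t assume "t \<in> ?F ` occ132 w"
    then obtain x y z where t: "t = (f x, f y, f z)" "subseq [x, y, z] w" "x < z" "z < y"
      by (auto simp: occ132_def)
    then show "t \<in> occ132 (map f w)"
      using subseq_imp_set_subset[OF t(2)] less subseq_map[OF t(2), of f] by (auto simp: occ132_def)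
  qed
  moreover have "inj_on ?F (occ132 w)"
  proof -
    have "inj_on (map_prod f (map_prod f f)) (set w \<times> set w \<times> set w)"
      using inj by (intro map_prod_inj_on)
    moreover have "map_prod f (map_prod f f) = ?F" by auto
    ultimately show ?thesis using inj_on_subset occ132_subset by metis
  qed
  ultimately show ?thesis by (simp add: card_image)
qed

text \<open>An occurrence not inside one factor would take \<open>m\<close> as its smallest or
  middle letter, or have its smallest letter in \<open>u\<close> and its middle one in
  \<open>v\<close>; all of this is impossible.\<close>

lemma occ132_append_max:
  assumes uv: "\<forall>x\<in>set u. \<forall>z\<in>set v. z < x" and m: "\<forall>y\<in>set u \<union> set v. y < m"
  shows "occ132 (u @ m # v) = occ132 u \<union> occ132 v"
proof (intro set_eqI iffI)
  fix t assume t: "t \<in> occ132 (u @ m # v)"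
  obtain x y z where txyz: "t = (x, y, z)" by (cases t)
  have less: "x < z" "z < y" and sub: "subseq [x, y, z] (u @ m # v)"
    using t by (auto simp: txyz occ132_def)
  have setu: "subseq [x, y] u \<Longrightarrow> x \<in> set u \<and> y \<in> set u"
    using subseq_imp_set_subset by fastforce
  have setv: "subseq [y, z] v \<Longrightarrow> y \<in> set v \<and> z \<in> set v"
    using subseq_imp_set_subset by fastforce
  consider "subseq [x, y, z] u" | "subseq [x, y] u" "z = m \<or> z \<in> set v"
    | "x \<in> set u" "z \<in> set v" | "x = m" "subseq [y, z] v" | "subseq [x, y, z] v"
    using sub setv
    by (auto simp: subseq_3_append_iff subseq_2_Cons_iff subseq_3_Cons_iff simp del: subseq_Cons2_iff)
  then show "t \<in> occ132 u \<union> occ132 v"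
  proof cases
    case 2
    then show ?thesis using setu uv m less by (metis Un_iff order.asym)
  next
    case 3
    then show ?thesis using uv less by (metis order.asym)
  next
    case 4
    then show ?thesis using setv m less by (metis Un_iff order.asym)
  qed (use less in \<open>auto simp: txyz occ132_def\<close>)
qed (auto simp: occ132_def subseq_3_append_iff subseq_3_Cons_iff simp del: subseq_Cons2_iff)

text \<open>Since \<open>m\<close> is largest and \<open>u\<close> lies above \<open>a\<close> and
  \<open>v\<close>, no occurrence starts in \<open>u\<close> and leaves it. As \<open>b\<close> is
  the only letter of \<open>v\<close> above \<open>a\<close>, one starting at \<open>a\<close> has
  to be \<open>a m b\<close>.\<close>

lemma occ132_append_min_max:
  assumes b: "b \<in> set v" "a < b" "b < m" and v: "\<forall>z\<in>set v - {b}. z < a"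
    and u: "\<forall>x\<in>set u. b < x \<and> x < m"
  shows "occ132 (u @ a # m # v) = insert (a, m, b) (occ132 u \<union> occ132 v)"
proof (intro set_eqI iffI)
  have v_le: "z \<le> b \<and> (a < z \<longrightarrow> z = b)" if "z \<in> set v" for z
  proof (cases "z = b")
    case False
    then have "z < a" using v that by blast
    then show ?thesis using b(2) by linarith
  qed simp
  fix t assume t: "t \<in> occ132 (u @ a # m # v)"
  obtain x y z where txyz: "t = (x, y, z)" by (cases t)
  have less: "x < z" "z < y" and sub: "subseq [x, y, z] (u @ a # m # v)"
    using t by (auto simp: txyz occ132_def)
  have setu: "subseq [x, y] u \<Longrightarrow> x \<in> set u \<and> y \<in> set u"
    using subseq_imp_set_subset by fastforce
  have setv: "subseq [y, z] v \<Longrightarrow> y \<in> set v \<and> z \<in> set v"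
    using subseq_imp_set_subset by fastforce
  have "subseq [x, y, z] u \<or> subseq [x, y] u \<and> (z = a \<or> z = m \<or> z \<in> set v) \<or>
      x \<in> set u \<and> (y = a \<and> (z = m \<or> z \<in> set v) \<or> y = m \<and> z \<in> set v \<or> subseq [y, z] v) \<or>
      x = a \<and> (y = m \<and> z \<in> set v \<or> subseq [y, z] v) \<or> x = m \<and> subseq [y, z] v \<or> subseq [x, y, z] v"
    using sub by (simp only: subseq_3_append_iff subseq_3_Cons_iff subseq_2_Cons_iff list.set insert_iff)
  then consider "subseq [x, y, z] u" | "x \<in> set u" "z = a \<or> z \<in> set v" | "subseq [x, y] u" "z = m"
    | "z = m" "y = a" | "x = a" "y = m" "z \<in> set v" | "x = a" "subseq [y, z] v"
    | "x = m" "subseq [y, z] v" | "subseq [x, y, z] v"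
    using setu setv by metis
  then show "t \<in> insert (a, m, b) (occ132 u \<union> occ132 v)"
  proof cases
    case 2
    then have "b < x" using u by blast
    moreover have "z \<le> b" using 2(2) b v_le[of z] by linarith
    ultimately show ?thesis using less by simp
  next
    case 3
    then have "y < m" using setu u by auto
    then show ?thesis using less 3 by simp
  next
    case 4
    then show ?thesis using less b by simp
  next
    case 5
    then show ?thesis using v_le[of z] less txyz by simp
  next
    case 6
    then have "z = b" "y \<le> b" using v_le[of y] v_le[of z] setv less by blast+
    then show ?thesis using less by simp
  next
    case 7
    then have "z \<le> b" using v_le[of z] setv by blast
    then show ?thesis using less b 7 by simp
  qed (use less in \<open>auto simp: txyz occ132_def\<close>)
next
  fix t assume "t \<in> insert (a, m, b) (occ132 u \<union> occ132 v)"
  then show "t \<in> occ132 (u @ a # m # v)"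
    using b
    by (auto simp: occ132_def subseq_3_append_iff subseq_3_Cons_iff subseq_2_Cons_iff
        simp del: subseq_Cons2_iff)
qed

text \<open>No element of \<open>A\<close> can lie below the maximum of \<open>B\<close>, so all
  numbers up to that maximum belong to \<open>B\<close>. This recovers the values of a factor of a
  word from their number alone.\<close>

lemma initial_segment:
  fixes A B :: "nat set"
  assumes "A \<union> B = {1..n}" "\<forall>x\<in>A. \<forall>z\<in>B. z < x"
  shows "B = {1..card B}" "A = {Suc (card B)..n}"
proof -
  have fin: "finite B" using assms(1) by (metis finite_Un finite_atLeastAtMost)
  show B: "B = {1..card B}"
  proof (cases "B = {}")
    case False
    define M where "M = Max B"
    have M: "M \<in> B" "\<And>i. i \<in> B \<Longrightarrow> i \<le> M" using fin False by (simp_all add: M_def)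
    have "i \<in> B \<longleftrightarrow> i \<in> {1..M}" for i
    proof
      assume "i \<in> {1..M}"
      moreover have "M \<in> {1..n}" using M(1) assms(1) by blast
      ultimately have "i \<in> A \<union> B" using assms(1) by auto
      then show "i \<in> B" using M assms(2) \<open>i \<in> {1..M}\<close> by (meson UnE leD atLeastAtMost_iff)
    next
      assume "i \<in> B"
      moreover have "i \<in> {1..n}" using \<open>i \<in> B\<close> assms(1) by blast
      ultimately show "i \<in> {1..M}" using M(2) by simp
    qed
    then have "B = {1..M}" by (rule set_eqI)
    then show ?thesis by simp
  qed auto
  have "A \<inter> B = {}" using assms(2) by blast
  then have "A = {1..n} - {1..card B}" using assms(1) B by blast
  then show "A = {Suc (card B)..n}" by auto
qed

section \<open>Gluing two words around a new maximum\<close>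

definition glue :: "nat list \<Rightarrow> nat list \<Rightarrow> nat list" where
  "glue u v = map (\<lambda>x. x + length v) u @ Suc (length u + length v) # v"

text \<open>
  In \<open>glue132 u v\<close> the letters \<open>a = length v\<close> in front of the maximum and \<open>b = length v + 1\<close>, which
  replaces the maximum of \<open>v\<close>, form the new occurrence of 1-3-2.
\<close>

definition glue132 :: "nat list \<Rightarrow> nat list \<Rightarrow> nat list" where
  "glue132 u v = map (\<lambda>x. x + Suc (length v)) u @ length v # (length u + length v + 2) #
     map (\<lambda>y. if y = length v then Suc y else y) v"

lemma length_glue: "length (glue u v) = length u + length v + 1"
  by (simp add: glue_def)

lemma length_glue132: "length (glue132 u v) = length u + length v + 2"
  by (simp add: glue132_def)

lemma set_perm_word: "w \<in> perm_words \<Longrightarrow> set w = {1..length w}"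
  by (simp add: perm_words_def)

lemma Nil_perm_words [simp]: "[] \<in> perm_words"
  by (simp add: perm_words_def)

text \<open>A list with as many different letters as entries cannot repeat a letter.\<close>

lemma perm_wordsI: "set w = {1..length w} \<Longrightarrow> w \<in> perm_words"
  unfolding perm_words_def by (simp add: card_distinct)

lemma image_shift: "(\<lambda>x. x + c) ` {1..n} = {Suc c..n + c :: nat}"
  using image_add_atLeastAtMost'[of c 1 n] by simp

lemma glue_perm_words:
  assumes "u \<in> perm_words" "v \<in> perm_words"
  shows "glue u v \<in> perm_words"
proof (rule perm_wordsI)
  have "set (glue u v) = (\<lambda>x. x + length v) ` {1..length u} \<union> {Suc (length u + length v)} \<union> {1..length v}"
    using set_perm_word[OF assms(1)] set_perm_word[OF assms(2)] by (auto simp: glue_def)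
  also have "\<dots> = {1..length (glue u v)}"
    unfolding image_shift length_glue by auto
  finally show "set (glue u v) = {1..length (glue u v)}" .
qed

text \<open>Moving the top value \<open>r\<close> up to \<open>Suc r\<close> keeps the order and
  frees \<open>r\<close> for the letter in front of the maximum in \<open>glue132\<close>.\<close>

lemma strict_mono_on_skip: "strict_mono_on {1..r} (\<lambda>y. if y = r then Suc y else y)"
  by (rule strict_mono_onI) auto

lemma strict_mono_on_shift: "strict_mono_on A (\<lambda>x. x + (c :: nat))"
  by (rule strict_mono_onI) auto

lemma image_skip: "0 < r \<Longrightarrow> (\<lambda>y. if y = r then Suc y else y) ` {1..r} = {1..<r} \<union> {Suc r}"
  by (force simp: image_iff)

lemma glue132_perm_words:
  assumes "u \<in> perm_words" "v \<in> perm_words" "v \<noteq> []"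
  shows "glue132 u v \<in> perm_words"
proof (rule perm_wordsI)
  have "set (glue132 u v) = (\<lambda>x. x + Suc (length v)) ` {1..length u} \<union> {length v, length u + length v + 2}
      \<union> (\<lambda>y. if y = length v then Suc y else y) ` {1..length v}"
    using set_perm_word[OF assms(1)] set_perm_word[OF assms(2)] by (auto simp: glue132_def)
  also have "\<dots> = {1..length (glue132 u v)}"
    using assms(3) unfolding image_shift length_glue132 by (subst image_skip) (auto simp: Suc_le_eq)
  finally show "set (glue132 u v) = {1..length (glue132 u v)}" .
qed

lemma card_occ132_glue:
  assumes "u \<in> perm_words" "v \<in> perm_words"
  shows "card (occ132 (glue u v)) = card (occ132 u) + card (occ132 v)"
proof -
  let ?u = "map (\<lambda>x. x + length v) u"
  have su: "set ?u = {Suc (length v)..length u + length v}"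
    by (simp only: set_map set_perm_word[OF assms(1)] image_shift)
  have sv: "set v = {1..length v}" using set_perm_word[OF assms(2)] .
  have "occ132 (glue u v) = occ132 ?u \<union> occ132 v"
    unfolding glue_def using su sv by (intro occ132_append_max) auto
  moreover have "occ132 ?u \<inter> occ132 v = {}"
    using occ132_subset[of ?u] occ132_subset[of v] unfolding su sv by fastforce
  moreover have "card (occ132 ?u) = card (occ132 u)"
    by (rule card_occ132_map[OF strict_mono_on_shift subset_refl])
  ultimately show ?thesis by (simp add: card_Un_disjoint)
qed

text \<open>The two parts use disjoint sets of letters, and the added triple contains the letter
  \<open>length v\<close>, which neither part uses.\<close>

lemma card_occ132_glue132:
  assumes "u \<in> perm_words" "v \<in> perm_words" "v \<noteq> []"
  shows "card (occ132 (glue132 u v)) = Suc (card (occ132 u) + card (occ132 v))"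
proof -
  let ?r = "length v"
  let ?u = "map (\<lambda>x. x + Suc ?r) u" and ?v = "map (\<lambda>y. if y = ?r then Suc y else y) v"
  have su: "set ?u = {Suc (Suc ?r)..length u + Suc ?r}"
    by (simp only: set_map set_perm_word[OF assms(1)] image_shift)
  have r: "0 < ?r" using assms(3) by simp
  have sv: "set ?v = {1..<?r} \<union> {Suc ?r}"
    using image_skip[OF r] set_perm_word[OF assms(2)] by simp
  have "occ132 (glue132 u v) = insert (?r, length u + ?r + 2, Suc ?r) (occ132 ?u \<union> occ132 ?v)"
    unfolding glue132_def by (intro occ132_append_min_max) (unfold su sv, auto)
  moreover have "occ132 ?u \<inter> occ132 ?v = {}"
    using occ132_subset[of ?u] occ132_subset[of ?v] unfolding su sv by fastforce
  moreover have "(?r, length u + ?r + 2, Suc ?r) \<notin> occ132 ?u \<union> occ132 ?v"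
    using occ132_subset[of ?u] occ132_subset[of ?v] unfolding su sv by fastforce
  moreover have "card (occ132 ?u) = card (occ132 u)"
    by (rule card_occ132_map[OF strict_mono_on_shift subset_refl])
  moreover have "card (occ132 ?v) = card (occ132 v)"
    by (rule card_occ132_map[OF strict_mono_on_skip]) (simp add: set_perm_word[OF assms(2)])
  ultimately show ?thesis by (simp add: card_Un_disjoint)
qed

lemma occ12_glue:
  assumes "u \<in> perm_words" "v \<in> perm_words"
  shows "occ12 (Suc j) (glue u v) = occ12 (Suc j) u + occ12 (Suc j) v + occ12 j u"
proof -
  let ?u = "map (\<lambda>x. x + length v) u"
  have su: "set ?u = {Suc (length v)..length u + length v}"
    by (simp only: set_map set_perm_word[OF assms(1)] image_shift)
  have sv: "set v = {1..length v}" using set_perm_word[OF assms(2)] .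
  have "occ12 (Suc j) (glue u v) = occ12 (Suc j) ?u + occ12 (Suc j) v + occ12 j ?u"
    unfolding glue_def
  proof (rule occ12_append_max)
    show "\<forall>x\<in>set (butlast ?u). \<forall>z\<in>set v. z \<le> x"
      using in_set_butlastD[of _ ?u] unfolding su sv by fastforce
  qed (use su sv in auto)
  moreover have "occ12 i ?u = occ12 i u" for i
    by (rule occ12_map[OF strict_mono_on_shift subset_refl])
  ultimately show ?thesis by simp
qed

text \<open>This is \<open>occ12_append_max\<close> with \<open>length v\<close> as last letter of
  the left block. That block is nonempty, which gives 1 for \<open>j = 0\<close>; for
  \<open>j > 0\<close> its minimal last letter does not count.\<close>

lemma occ12_glue132:
  assumes "u \<in> perm_words" "v \<in> perm_words" "v \<noteq> []"
  shows "occ12 (Suc j) (glue132 u v) =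
    occ12 (Suc j) u + occ12 (Suc j) v + (if j = 0 then 1 else occ12 j u)"
proof -
  let ?r = "length v"
  let ?u = "map (\<lambda>x. x + Suc ?r) u" and ?v = "map (\<lambda>y. if y = ?r then Suc y else y) v"
  have su: "set ?u = {Suc (Suc ?r)..length u + Suc ?r}"
    by (simp only: set_map set_perm_word[OF assms(1)] image_shift)
  have r: "0 < ?r" using assms(3) by simp
  have sv: "set ?v = {1..<?r} \<union> {Suc ?r}"
    using image_skip[OF r] set_perm_word[OF assms(2)] by simp
  have min: "occ12 (Suc i) (?u @ [?r]) = occ12 (Suc i) u" for i
  proof -
    have "occ12 (Suc i) (?u @ [?r]) = occ12 (Suc i) ?u"
      by (rule occ12_append_min) (unfold su, auto)
    also have "\<dots> = occ12 (Suc i) u"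
      by (rule occ12_map[OF strict_mono_on_shift subset_refl])
    finally show ?thesis .
  qed
  have "occ12 (Suc j) ((?u @ [?r]) @ (length u + ?r + 2) # ?v) =
      occ12 (Suc j) (?u @ [?r]) + occ12 (Suc j) ?v + occ12 j (?u @ [?r])"
  proof (rule occ12_append_max)
    show "\<forall>x\<in>set (butlast (?u @ [?r])). \<forall>z\<in>set ?v. z \<le> x"
      unfolding butlast_snoc su sv by auto
    show "\<forall>y\<in>set (?u @ [?r]) \<union> set ?v. y < length u + ?r + 2"
      unfolding set_append su sv by auto
  qed
  moreover have "occ12 (Suc j) ?v = occ12 (Suc j) v"
    by (rule occ12_map[OF strict_mono_on_skip]) (simp add: set_perm_word[OF assms(2)])
  ultimately show ?thesis
    using min by (cases j) (simp_all add: glue132_def)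
qed

text \<open>The maximum occurs exactly once, so it marks the cut; the right factor then fixes the
  shift of the left one.\<close>

lemma glue_inject:
  assumes "u \<in> perm_words" "v \<in> perm_words" "u' \<in> perm_words" "v' \<in> perm_words"
    and eq: "glue u v = glue u' v'"
  shows "u = u' \<and> v = v'"
proof -
  have len: "length u + length v = length u' + length v'"
    using arg_cong[OF eq, of length] by (simp add: length_glue)
  have "map (\<lambda>x. x + length v) u = map (\<lambda>x. x + length v') u' \<and> v = v'"
  proof (rule append_Cons_eq_iff[THEN iffD1])
    show "map (\<lambda>x. x + length v) u @ Suc (length u + length v) # v =
        map (\<lambda>x. x + length v') u' @ Suc (length u + length v) # v'"
      using eq len by (simp add: glue_def)
  qed (use assms(1-4)[THEN set_perm_word] in auto)
  then show ?thesis by (auto dest: map_injective simp: inj_def)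
qed

text \<open>Cutting at the maximum and reading the letter before it recovers
  \<open>length v\<close>, hence both relabellings, which are injective.\<close>

lemma glue132_inject:
  assumes "u \<in> perm_words" "v \<in> perm_words" "u' \<in> perm_words" "v' \<in> perm_words"
    and eq: "glue132 u v = glue132 u' v'"
  shows "u = u' \<and> v = v'"
proof -
  let ?g = "\<lambda>v y. if y = length v then Suc y else y :: nat"
  have len: "length u + length v = length u' + length v'"
    using arg_cong[OF eq, of length] by (simp add: length_glue132)
  have "(map (\<lambda>x. x + Suc (length v)) u @ [length v]) @ (length u + length v + 2) # map (?g v) v
      = (map (\<lambda>x. x + Suc (length v')) u' @ [length v']) @ (length u + length v + 2) # map (?g v') v'"
    using eq len by (simp add: glue132_def)
  then have "map (\<lambda>x. x + Suc (length v)) u @ [length v] = map (\<lambda>x. x + Suc (length v')) u' @ [length v']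
      \<and> map (?g v) v = map (?g v') v'"
    using len assms(1-4)[THEN set_perm_word]
    by (subst (asm) append_Cons_eq_iff) (auto split: if_splits)
  then have *: "map (\<lambda>x. x + Suc (length v)) u = map (\<lambda>x. x + Suc (length v)) u'" "length v = length v'"
    "map (?g v) v = map (?g v) v'"
    by auto
  have "inj_on (?g v) (set v \<union> set v')"
    using strict_mono_on_imp_inj_on[OF strict_mono_on_skip[of "length v"]] *(2)
      assms(2,4)[THEN set_perm_word] by simp
  then have "v = v'" using *(3) by (simp add: inj_on_map_eq_map)
  moreover have "u = u'" using *(1) by (auto dest: map_injective simp: inj_def)
  ultimately show ?thesis by simp
qed

text \<open>In \<open>glue132\<close> the letter before the maximum equals the length of the right
  factor; in \<open>glue\<close> every letter left of the maximum exceeds that length.\<close>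

lemma glue_neq_glue132:
  assumes "u \<in> perm_words" "v \<in> perm_words" "u' \<in> perm_words" "v' \<in> perm_words" "v' \<noteq> []"
  shows "glue u v \<noteq> glue132 u' v'"
proof
  assume eq: "glue u v = glue132 u' v'"
  let ?g = "\<lambda>y. if y = length v' then Suc y else y :: nat"
  have len: "length u + length v = length u' + length v' + 1"
    using arg_cong[OF eq, of length] by (simp add: length_glue length_glue132)
  have "map (\<lambda>x. x + length v) u @ (length u + length v + 1) # v
      = (map (\<lambda>x. x + Suc (length v')) u' @ [length v']) @ (length u + length v + 1) # map ?g v'"
    using eq len by (simp add: glue132_def glue_def)
  then have "map (\<lambda>x. x + length v) u = map (\<lambda>x. x + Suc (length v')) u' @ [length v'] \<and> v = map ?g v'"
    by (rule append_Cons_eq_iff[THEN iffD1, rotated 2])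
      (auto simp: assms(1,2)[THEN set_perm_word])
  then have *: "map (\<lambda>x. x + length v) u = map (\<lambda>x. x + Suc (length v')) u' @ [length v']"
    "v = map ?g v'"
    by blast+
  have "length v' \<in> (\<lambda>x. x + length v) ` set u" using arg_cong[OF *(1), of set] by auto
  then show False using arg_cong[OF *(2), of length] set_perm_word[OF assms(1)] by auto
qed

lemma shift_image_eqD:
  assumes "(\<lambda>x. x + c) ` S = {Suc c..n + c :: nat}"
  shows "S = {1..n}"
  using assms unfolding image_shift[symmetric] by (subst (asm) inj_image_eq_iff) (auto simp: inj_def)

lemma perm_word_decomposition:
  assumes w: "w \<in> perm_words" "w \<noteq> []" and card: "card (occ132 w) \<le> 1"
  shows "(\<exists>u\<in>perm_words. \<exists>v\<in>perm_words. w = glue u v) \<or>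
    (\<exists>u\<in>perm_words. \<exists>v\<in>perm_words - {[]}. w = glue132 u v)"
proof -
  define m where "m = length w"
  have "m \<in> set w" using w by (simp add: m_def set_perm_word Suc_le_eq)
  then obtain p q where wpq: "w = p @ m # q" by (meson split_list)
  have dist: "distinct (p @ m # q)" using w wpq by (simp add: perm_words_def)
  define n where "n = length p + length q"
  have m: "m = Suc n" using arg_cong[OF wpq, of length] by (simp add: n_def m_def)
  have ins: "insert m (set p \<union> set q) = {1..Suc n}"
    using set_perm_word[OF w(1)] wpq m m_def by auto
  have "set p \<union> set q = insert m (set p \<union> set q) - {m}" using dist by auto
  also have "\<dots> = {1..n}" unfolding ins using m by auto
  finally have pq: "set p \<union> set q = {1..n}" .
  have lt: "x < m" if "x \<in> set p \<union> set q" for x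
    using that m unfolding pq by simp
  show ?thesis
  proof (cases "\<forall>x\<in>set p. \<forall>z\<in>set q. z < x")
    case True
    have cq: "card (set q) = length q" using dist by (simp add: distinct_card)
    have sq: "set q = {1..length q}" and sp: "set p = {Suc (length q)..n}"
      using initial_segment[OF pq True] unfolding cq by auto
    define u where "u = map (\<lambda>x. x - length q) p"
    have up: "map (\<lambda>x. x + length q) u = p"
      unfolding u_def map_map by (rule map_idI) (auto simp: sp)
    have "set u = {1..length u}"
    proof -
      have lu: "length u = length p" by (simp add: u_def)
      show ?thesis
        by (rule shift_image_eqD, unfold lu) (use arg_cong[OF up, of set] in \<open>simp only: set_map sp n_def\<close>)
    qed
    then have "u \<in> perm_words" by (rule perm_wordsI)
    moreover have "q \<in> perm_words" using sq by (rule perm_wordsI)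
    moreover have "w = glue u q"
      using wpq up m by (simp add: glue_def n_def) (simp add: u_def)
    ultimately show ?thesis by blast
  next
    case False
    then obtain a b where ab: "a \<in> set p" "b \<in> set q" "a \<le> b" by (meson not_less)
    have "a < b" using ab dist by (metis IntI distinct_append empty_iff le_neq_implies_less list.set_intros(2))
    have uniq: "t = t'" if "t \<in> occ132 w" "t' \<in> occ132 w" for t t'
      using card that by (simp add: card_le_Suc0_iff_eq)
    have abm: "(a, m, b) \<in> occ132 w"
      using ab \<open>a < b\<close> lt
      by (simp add: wpq occ132_def subseq_3_append_iff subseq_2_Cons_iff del: subseq_Cons2_iff)
    \<comment> \<open>Any rising pair across \<open>m\<close> gives an occurrence with
      \<open>m\<close>, so by uniqueness it is the pair \<open>a\<close>, \<open>b\<close>.\<close>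
    have cross: "x = a \<and> z = b" if "x \<in> set p" "z \<in> set q" "x < z" for x z
    proof -
      have "(x, m, z) \<in> occ132 w"
        using that lt
        by (simp add: wpq occ132_def subseq_3_append_iff subseq_2_Cons_iff del: subseq_Cons2_iff)
      then show ?thesis using uniq[OF abm] by auto
    qed
    obtain p1 p2 where p: "p = p1 @ a # p2" using ab(1) by (meson split_list)
    have b_less: "b < x" if "x \<in> set p" "x \<noteq> a" for x
    proof -
      have "x \<noteq> b" using that(1) ab(2) dist by auto
      then show ?thesis using cross[OF that(1) ab(2)] that(2) by linarith
    qed
    \<comment> \<open>A letter between \<open>a\<close> and \<open>m\<close> would exceed
      \<open>b\<close> and form a second occurrence with \<open>a\<close> and
      \<open>b\<close>.\<close>
    have "p2 = []"
    proof (rule ccontr)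
      assume "p2 \<noteq> []"
      then obtain y where y: "y \<in> set p2" by (meson list.set_sel(1))
      then have "y \<noteq> a" "y \<in> set p" using dist p by auto
      then have "b < y" using b_less by blast
      moreover have "subseq [a, y, b] w"
        using y ab(2)
        by (simp add: wpq p subseq_3_append_iff subseq_2_append_iff subseq_2_Cons_iff subseq_3_Cons_iff
            del: subseq_Cons2_iff append_assoc)
      ultimately have "(a, y, b) \<in> occ132 w" using \<open>a < b\<close> by (simp add: occ132_def)
      then have "y = m" using uniq[OF abm] by auto
      then show False using \<open>y \<in> set p\<close> dist by auto
    qed
    then have p: "p = p1 @ [a]" using p by simp
    have p1: "b < x" if "x \<in> set p1" for x
      using that dist p by (intro b_less) auto
    have q: "z < a" if "z \<in> set q" "z \<noteq> b" for z
    proof -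
      have "z \<noteq> a" using that(1) ab(1) dist by auto
      then show ?thesis using cross[OF ab(1) that(1)] that(2) by linarith
    qed
    define r where "r = length q"
    have r: "0 < r" using ab(2) by (auto simp: r_def)
    have cq: "card (set q) = r" using dist by (simp add: distinct_card r_def)
    have c1: "card (set q - {b}) = r - 1" using cq ab(2) by simp
    have aq: "a \<notin> set q" using ab(1) dist by auto
    then have c2: "card (insert a (set q - {b})) = r"
      using c1 r by (simp add: card_insert_if)
    have c3: "card (insert a (set q)) = Suc r" using aq cq by simp
    \<comment> \<open>Three nested initial segments, of sizes \<open>r - 1\<close>, \<open>r\<close>
      and \<open>r + 1\<close>, determine the values: passing to the second adds \<open>a\<close>,
      to the third adds \<open>b\<close>.\<close>
    have s1: "set q - {b} = {1..r - 1}"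
    proof -
      have U: "({a, b} \<union> set p1) \<union> (set q - {b}) = {1..n}"
        unfolding pq[symmetric] p using ab(2) by auto
      have "\<forall>x\<in>{a, b} \<union> set p1. \<forall>z\<in>set q - {b}. z < x"
      proof (intro ballI)
        fix x z assume "x \<in> {a, b} \<union> set p1" "z \<in> set q - {b}"
        then show "z < x" using q[of z] p1[of x] \<open>a < b\<close> by auto
      qed
      from initial_segment(1)[OF U this] show ?thesis unfolding c1 .
    qed
    have s2: "insert a (set q - {b}) = {1..r}"
    proof -
      have U: "({b} \<union> set p1) \<union> insert a (set q - {b}) = {1..n}"
        unfolding pq[symmetric] p using ab(2) by auto
      have "\<forall>x\<in>{b} \<union> set p1. \<forall>z\<in>insert a (set q - {b}). z < x"
      proof (intro ballI)
        fix x z assume "x \<in> {b} \<union> set p1" "z \<in> insert a (set q - {b})"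
        then show "z < x" using q[of z] p1[of x] \<open>a < b\<close> by auto
      qed
      from initial_segment(1)[OF U this] show ?thesis unfolding c2 .
    qed
    have s3: "insert a (set q) = {1..Suc r}" "set p1 = {Suc (Suc r)..n}"
    proof -
      have U: "set p1 \<union> insert a (set q) = {1..n}"
        unfolding pq[symmetric] p by auto
      have *: "\<forall>x\<in>set p1. \<forall>z\<in>insert a (set q). z < x"
      proof (intro ballI)
        fix x z assume "x \<in> set p1" "z \<in> insert a (set q)"
        then show "z < x" using q[of z] p1[of x] \<open>a < b\<close> by (cases "z = b") auto
      qed
      show "insert a (set q) = {1..Suc r}" "set p1 = {Suc (Suc r)..n}"
        using initial_segment[OF U *] unfolding c3 .
    qed
    have "a = r"
    proof -
      have "r \<in> insert a (set q - {b})" unfolding s2 using r by simp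
      moreover have "r \<notin> set q - {b}" unfolding s1 using r by simp
      ultimately show ?thesis by blast
    qed
    have "b = Suc r"
    proof -
      have "Suc r \<in> insert a (set q)" unfolding s3 by simp
      moreover have "Suc r \<notin> insert a (set q - {b})" unfolding s2 by simp
      ultimately show ?thesis by blast
    qed
    have sq: "set q = {1..<r} \<union> {Suc r}"
    proof -
      have "set q = insert b (set q - {b})" using ab(2) by blast
      also have "\<dots> = {1..<r} \<union> {Suc r}" unfolding s1 using \<open>b = Suc r\<close> r by auto
      finally show ?thesis .
    qed
    define u where "u = map (\<lambda>x. x - Suc r) p1"
    have up: "map (\<lambda>x. x + Suc r) u = p1"
      unfolding u_def map_map by (rule map_idI) (auto simp: s3)
    have "set u = {1..length u}"
    proof -
      have lu: "n = length u + Suc r" by (simp add: u_def n_def p r_def)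
      show ?thesis
        by (rule shift_image_eqD[of "Suc r"], fold lu) (use arg_cong[OF up, of set] in \<open>simp only: set_map s3\<close>)
    qed
    then have u: "u \<in> perm_words" by (rule perm_wordsI)
    \<comment> \<open>Undoing the skip: the letter \<open>b = Suc r\<close> returns to the value
      \<open>r\<close>, which \<open>a\<close> had taken.\<close>
    define v where "v = map (\<lambda>y. if y = Suc r then r else y) q"
    have vq: "map (\<lambda>y. if y = r then Suc y else y) v = q"
      unfolding v_def map_map by (rule map_idI) (auto simp: sq)
    have lv: "length v = r" by (simp add: v_def r_def)
    have "set v = {1..length v}"
      unfolding lv unfolding v_def using r by (auto simp: sq image_iff)
    then have v: "v \<in> perm_words" by (rule perm_wordsI)
    have "w = glue132 u v"
      unfolding glue132_def lv up vq
      using wpq p m \<open>a = r\<close> by (simp add: n_def r_def u_def)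
    then show ?thesis using u v lv r by auto
  qed
qed

section \<open>Generating functions\<close>

definition gf :: "nat list set \<Rightarrow> real fps" where
  "gf X = Abs_fps (\<lambda>n. of_nat (card {w \<in> X. length w = n}))"

lemma finite_perm_words_length:
  assumes "X \<subseteq> perm_words"
  shows "finite {w \<in> X. length w = n}"
  by (rule finite_subset[OF _ finite_lists_length_eq[of "{1..n}" n]])
    (use assms set_perm_word in \<open>auto simp: subset_iff\<close>)

lemma gf_Un:
  assumes "X \<subseteq> perm_words" "Y \<subseteq> perm_words" "X \<inter> Y = {}"
  shows "gf (X \<union> Y) = gf X + gf Y"
proof (rule fps_ext)
  fix n
  have "{w \<in> X \<union> Y. length w = n} = {w \<in> X. length w = n} \<union> {w \<in> Y. length w = n}" by auto
  moreover have "{w \<in> X. length w = n} \<inter> {w \<in> Y. length w = n} = {}" using assms(3) by auto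
  ultimately show "gf (X \<union> Y) $ n = (gf X + gf Y) $ n"
    using assms finite_perm_words_length by (simp add: gf_def card_Un_disjoint)
qed

lemma gf_Nil: "gf {[]} = 1"
proof (rule fps_ext)
  fix n
  have "{w \<in> {[]}. length w = n} = (if n = 0 then {[]} else {} :: nat list set)" by auto
  then show "gf {[]} $ n = 1 $ n" by (simp add: gf_def)
qed

lemma gf_minus_Nil:
  assumes "X \<subseteq> perm_words" "[] \<in> X"
  shows "gf (X - {[]}) = gf X - 1"
proof -
  have "gf X = gf (X - {[]}) + gf {[]}"
    using assms by (subst gf_Un[symmetric]) (auto simp: insert_absorb)
  then show ?thesis by (simp add: gf_Nil)
qed

text \<open>Pairs of total length \<open>n - c\<close> split by the length of the first word, which
  gives the Cauchy product; \<open>c\<close> counts the letters that \<open>f\<close> adds.\<close>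

lemma gf_image:
  assumes XY: "X \<subseteq> perm_words" "Y \<subseteq> perm_words" and inj: "inj_on (case_prod f) (X \<times> Y)"
    and len: "\<And>u v. length (f u v) = length u + length v + c"
  shows "gf (case_prod f ` (X \<times> Y)) = fps_X ^ c * gf X * gf Y"
proof (rule fps_ext)
  fix n
  let ?S = "\<lambda>Z i. {w \<in> Z. length w = i}"
  show "gf (case_prod f ` (X \<times> Y)) $ n = (fps_X ^ c * gf X * gf Y) $ n"
  proof (cases "n < c")
    case True
    then have "?S (case_prod f ` (X \<times> Y)) n = {}" using len by auto
    then show ?thesis using True
      by (simp add: gf_def mult.assoc fps_X_power_mult_nth del: Collect_empty_eq)
  next
    case False
    define m where "m = n - c"
    let ?P = "\<Union>i\<in>{0..m}. ?S X i \<times> ?S Y (m - i)"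
    have P: "?P = {(u, v). u \<in> X \<and> v \<in> Y \<and> length u + length v = m}" by auto
    have "?S (case_prod f ` (X \<times> Y)) n = case_prod f ` ?P"
      unfolding P using False len by (fastforce simp: m_def)
    moreover have "inj_on (case_prod f) ?P" by (rule inj_on_subset[OF inj]) auto
    ultimately have "card (?S (case_prod f ` (X \<times> Y)) n) = card ?P"
      by (simp add: card_image)
    also have "\<dots> = (\<Sum>i=0..m. card (?S X i \<times> ?S Y (m - i)))"
      using XY finite_perm_words_length by (intro card_UN_disjoint) auto
    finally have "gf (case_prod f ` (X \<times> Y)) $ n = (gf X * gf Y) $ m"
      by (simp add: gf_def fps_mult_nth card_cartesian_product)
    also have "\<dots> = (fps_X ^ c * gf X * gf Y) $ n"
      unfolding mult.assoc fps_X_power_mult_nth using False by (simp add: m_def)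
    finally show ?thesis .
  qed
qed

section \<open>Classes of words and sets of glued words\<close>

definition glue_set :: "nat list set \<Rightarrow> nat list set \<Rightarrow> nat list set" where
  "glue_set X Y = case_prod glue ` (X \<times> Y)"

definition glue132_set :: "nat list set \<Rightarrow> nat list set \<Rightarrow> nat list set" where
  "glue132_set X Y = case_prod glue132 ` (X \<times> Y)"

definition perm_class :: "nat \<Rightarrow> nat \<Rightarrow> nat \<Rightarrow> nat list set" where
  "perm_class d j c = {w \<in> perm_words. card (occ132 w) = d \<and> occ12 j w = c}"

lemma perm_class_subset [simp]: "perm_class d j c \<subseteq> perm_words"
  by (auto simp: perm_class_def)

lemma glue_set_subset [simp]:
  "X \<subseteq> perm_words \<Longrightarrow> Y \<subseteq> perm_words \<Longrightarrow> glue_set X Y \<subseteq> perm_words"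
  by (auto simp: glue_set_def intro: glue_perm_words)

lemma glue132_set_subset [simp]:
  "X \<subseteq> perm_words \<Longrightarrow> Y \<subseteq> perm_words - {[]} \<Longrightarrow> glue132_set X Y \<subseteq> perm_words"
  by (auto simp: glue132_set_def intro!: glue132_perm_words)

lemma gf_glue_set:
  assumes "X \<subseteq> perm_words" "Y \<subseteq> perm_words"
  shows "gf (glue_set X Y) = fps_X * gf X * gf Y"
proof -
  have "inj_on (case_prod glue) (X \<times> Y)"
  proof (rule inj_onI)
    fix s t assume "s \<in> X \<times> Y" "t \<in> X \<times> Y" "case_prod glue s = case_prod glue t"
    then show "s = t"
      using assms glue_inject[of "fst s" "snd s" "fst t" "snd t"]
      by (auto simp: case_prod_beta prod_eq_iff subset_iff)
  qed
  from gf_image[OF assms this length_glue] show ?thesis by (simp add: glue_set_def)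
qed

lemma gf_glue132_set:
  assumes "X \<subseteq> perm_words" "Y \<subseteq> perm_words - {[]}"
  shows "gf (glue132_set X Y) = fps_X\<^sup>2 * gf X * gf Y"
proof -
  have Y: "Y \<subseteq> perm_words" using assms(2) by auto
  have "inj_on (case_prod glue132) (X \<times> Y)"
  proof (rule inj_onI)
    fix s t assume "s \<in> X \<times> Y" "t \<in> X \<times> Y" "case_prod glue132 s = case_prod glue132 t"
    then show "s = t"
      using assms(1) Y glue132_inject[of "fst s" "snd s" "fst t" "snd t"]
      by (auto simp: case_prod_beta prod_eq_iff subset_iff)
  qed
  from gf_image[OF assms(1) Y this length_glue132] show ?thesis by (simp add: glue132_set_def)
qed

lemma glue_in_glue_set:
  assumes "u \<in> perm_words" "v \<in> perm_words" "X \<subseteq> perm_words" "Y \<subseteq> perm_words"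
  shows "glue u v \<in> glue_set X Y \<longleftrightarrow> u \<in> X \<and> v \<in> Y"
  unfolding glue_set_def using assms glue_inject[OF assms(1,2)] by (auto simp: image_iff subset_iff)

lemma glue132_in_glue132_set:
  assumes "u \<in> perm_words" "v \<in> perm_words" "X \<subseteq> perm_words" "Y \<subseteq> perm_words"
  shows "glue132 u v \<in> glue132_set X Y \<longleftrightarrow> u \<in> X \<and> v \<in> Y"
  unfolding glue132_set_def using assms glue132_inject[OF assms(1,2)] by (auto simp: image_iff subset_iff)

lemma glue132_notin_glue_set:
  assumes "u \<in> perm_words" "v \<in> perm_words - {[]}" "X \<subseteq> perm_words" "Y \<subseteq> perm_words"
  shows "glue132 u v \<notin> glue_set X Y"
proof
  assume "glue132 u v \<in> glue_set X Y"
  then obtain u' v' where "u' \<in> X" "v' \<in> Y" "glue u' v' = glue132 u v"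
    by (auto simp: glue_set_def)
  then show False using assms glue_neq_glue132[of u' v' u v] by auto
qed

lemma glue_notin_glue132_set:
  assumes "u \<in> perm_words" "v \<in> perm_words" "X \<subseteq> perm_words" "Y \<subseteq> perm_words - {[]}"
  shows "glue u v \<notin> glue132_set X Y"
proof
  assume "glue u v \<in> glue132_set X Y"
  then obtain u' v' where "u' \<in> X" "v' \<in> Y" "glue u v = glue132 u' v'"
    by (auto simp: glue132_set_def)
  then show False using assms glue_neq_glue132[of u v u' v'] by auto
qed

lemma Nil_notin_glue_set: "[] \<notin> glue_set X Y" "[] \<notin> glue132_set X Y"
  by (auto simp: glue_set_def glue_def glue132_set_def glue132_def)

lemma glue_set_disjoint:
  assumes "X \<subseteq> perm_words" "Y \<subseteq> perm_words" "X' \<subseteq> perm_words" "Y' \<subseteq> perm_words"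
    "X \<inter> X' = {} \<or> Y \<inter> Y' = {}"
  shows "glue_set X Y \<inter> glue_set X' Y' = {}"
proof -
  have "False" if "u \<in> X" "v \<in> Y" "glue u v \<in> glue_set X' Y'" for u v
    using that assms glue_in_glue_set[of u v X' Y'] by blast
  then show ?thesis by (auto simp: glue_set_def[of X Y])
qed

lemma glue132_set_disjoint:
  assumes "X \<subseteq> perm_words" "Y \<subseteq> perm_words" "X' \<subseteq> perm_words" "Y' \<subseteq> perm_words"
    "X \<inter> X' = {} \<or> Y \<inter> Y' = {}"
  shows "glue132_set X Y \<inter> glue132_set X' Y' = {}"
proof -
  have "False" if "u \<in> X" "v \<in> Y" "glue132 u v \<in> glue132_set X' Y'" for u v
    using that assms glue132_in_glue132_set[of u v X' Y'] by blast
  then show ?thesis by (auto simp: glue132_set_def[of X Y])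
qed

lemma glue_set_glue132_set_disjoint:
  assumes "X \<subseteq> perm_words" "Y \<subseteq> perm_words" "X' \<subseteq> perm_words" "Y' \<subseteq> perm_words - {[]}"
  shows "glue_set X Y \<inter> glue132_set X' Y' = {}"
proof -
  have "False" if "u \<in> X" "v \<in> Y" "glue u v \<in> glue132_set X' Y'" for u v
    using that assms glue_notin_glue132_set[of u v X' Y'] by blast
  then show ?thesis by (auto simp: glue_set_def[of X Y])
qed

lemma perm_class_disjoint: "d \<noteq> d' \<or> c \<noteq> c' \<Longrightarrow> perm_class d j c \<inter> perm_class d' j c' = {}"
  by (auto simp: perm_class_def)

definition glued :: "nat list set" where
  "glued = {[]} \<union> glue_set perm_words perm_words \<union> glue132_set perm_words (perm_words - {[]})"

lemma subset_glued [simp]: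
  "[] \<in> glued"
  "X \<subseteq> perm_words \<Longrightarrow> Y \<subseteq> perm_words \<Longrightarrow> glue_set X Y \<subseteq> glued"
  "X \<subseteq> perm_words \<Longrightarrow> Y \<subseteq> perm_words - {[]} \<Longrightarrow> glue132_set X Y \<subseteq> glued"
  unfolding glued_def glue_set_def glue132_set_def by blast+

text \<open>By \<open>perm_word_decomposition\<close> every word with at most one 1-3-2 is empty or
  glued, and so are the words of \<open>S\<close>; membership need only be compared on these three
  forms.\<close>

lemma perm_class_eqI:
  assumes d: "d \<le> 1"
    and S: "S \<subseteq> glued"
    and Nil: "[] \<in> perm_class d j c \<longleftrightarrow> [] \<in> S"
    and glue: "\<And>u v. u \<in> perm_words \<Longrightarrow> v \<in> perm_words \<Longrightarrow>
      glue u v \<in> perm_class d j c \<longleftrightarrow> glue u v \<in> S"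
    and glue132: "\<And>u v. u \<in> perm_words \<Longrightarrow> v \<in> perm_words - {[]} \<Longrightarrow>
      glue132 u v \<in> perm_class d j c \<longleftrightarrow> glue132 u v \<in> S"
  shows "perm_class d j c = S"
proof -
  have "w \<in> glued" if "w \<in> perm_class d j c" for w
    using that d perm_word_decomposition[of w]
    by (fastforce simp: glued_def perm_class_def glue_set_def glue132_set_def)
  then have "perm_class d j c \<subseteq> glued" by blast
  moreover have "w \<in> perm_class d j c \<longleftrightarrow> w \<in> S" if "w \<in> glued" for w
    using that Nil glue glue132 by (auto simp: glued_def glue_set_def glue132_set_def)
  ultimately show ?thesis using S by blast
qed

lemma mem_perm_class:
  "w \<in> perm_words \<Longrightarrow> w \<in> perm_class d j c \<longleftrightarrow> card (occ132 w) = d \<and> occ12 j w = c"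
  by (simp add: perm_class_def)

lemma Nil_in_perm_class: "[] \<in> perm_class d j c \<longleftrightarrow> d = 0 \<and> c = 0"
  by (auto simp: perm_class_def)

text \<open>\<open>m\<close> stands for the contribution of the right factor. Zero occurrences of
  the shorter pattern in \<open>u\<close> exclude the longer one, so a single count of
  \<open>u\<close> decides.\<close>

lemma occ12_sum_0: "occ12 (Suc j) u + m + occ12 j u = 0 \<longleftrightarrow> occ12 j u = 0 \<and> m = 0"
  using occ12_eq_0_Suc[of j u] by auto

text \<open>A single occurrence of the shorter pattern excludes the longer one as well, so the 1
  comes from that occurrence or from the right factor.\<close>

lemma occ12_sum_1:
  "occ12 (Suc (Suc j)) u + m + occ12 (Suc j) u = Suc 0 \<longleftrightarrow>
     occ12 (Suc j) u = 0 \<and> m = Suc 0 \<or> occ12 (Suc j) u = Suc 0 \<and> m = 0"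
  using occ12_eq_0_Suc[of "Suc j" u] occ12_eq_1_Suc[of j u] by auto

context
  fixes u v :: "nat list" and d j :: nat
  assumes u: "u \<in> perm_words" and v: "v \<in> perm_words"
begin

text \<open>Count 1 for the pattern 12 is separate: \<open>occ12 0\<close> only tests whether
  \<open>u\<close> is empty, and a nonempty \<open>u\<close> already supplies the ascent into the
  maximum.\<close>

lemma glue_in_perm_class:
  "glue u v \<in> perm_class d (Suc j) 0 \<longleftrightarrow>
     card (occ132 u) + card (occ132 v) = d \<and> occ12 j u = 0 \<and> occ12 (Suc j) v = 0"
  "glue u v \<in> perm_class d (Suc 0) (Suc 0) \<longleftrightarrow>
     card (occ132 u) + card (occ132 v) = d \<and>
     (u = [] \<and> occ12 (Suc 0) v = Suc 0 \<or>
      u \<noteq> [] \<and> occ12 (Suc 0) u = 0 \<and> occ12 (Suc 0) v = 0)"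
  "glue u v \<in> perm_class d (Suc (Suc j)) (Suc 0) \<longleftrightarrow>
     card (occ132 u) + card (occ132 v) = d \<and>
     (occ12 (Suc j) u = 0 \<and> occ12 (Suc (Suc j)) v = Suc 0 \<or>
      occ12 (Suc j) u = Suc 0 \<and> occ12 (Suc (Suc j)) v = 0)"
  unfolding mem_perm_class[OF glue_perm_words[OF u v]] card_occ132_glue[OF u v] occ12_glue[OF u v]
    occ12_sum_0 occ12_sum_1
  by auto

text \<open>The letter \<open>length v\<close> and the maximum always form an ascent, so index 1
  never has count 0, and for count 1 this ascent is the only one.\<close>

lemma glue132_in_perm_class:
  assumes "v \<noteq> []"
  shows "glue132 u v \<notin> perm_class 0 j c"
    "glue132 u v \<notin> perm_class d (Suc 0) 0"
    "glue132 u v \<in> perm_class (Suc d) (Suc (Suc j)) 0 \<longleftrightarrow>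
       card (occ132 u) + card (occ132 v) = d \<and> occ12 (Suc j) u = 0 \<and> occ12 (Suc (Suc j)) v = 0"
    "glue132 u v \<in> perm_class (Suc d) (Suc 0) (Suc 0) \<longleftrightarrow>
       card (occ132 u) + card (occ132 v) = d \<and> occ12 (Suc 0) u = 0 \<and> occ12 (Suc 0) v = 0"
    "glue132 u v \<in> perm_class (Suc d) (Suc (Suc j)) (Suc 0) \<longleftrightarrow>
       card (occ132 u) + card (occ132 v) = d \<and>
       (occ12 (Suc j) u = 0 \<and> occ12 (Suc (Suc j)) v = Suc 0 \<or>
        occ12 (Suc j) u = Suc 0 \<and> occ12 (Suc (Suc j)) v = 0)"
  unfolding mem_perm_class[OF glue132_perm_words[OF u v assms]] card_occ132_glue132[OF u v assms]
    occ12_glue132[OF u v assms]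
  by (simp_all only: nat.simps if_False if_True occ12_sum_0 occ12_sum_1) auto

end

lemma perm_class_Diff_subset [simp]:
  "perm_class d j c - A \<subseteq> perm_words" "perm_class d j c - {[]} \<subseteq> perm_words - {[]}"
  by (auto simp: perm_class_def)

lemma perm_class_Suc_subset [simp]: "perm_class d j (Suc c) \<subseteq> perm_words - {[]}"
  by (auto simp: perm_class_def)

lemmas glue_membership = glue_in_glue_set glue132_in_glue132_set glue132_notin_glue_set
  glue_notin_glue132_set Nil_notin_glue_set glue_in_perm_class glue132_in_perm_class
  Nil_in_perm_class mem_perm_class

section \<open>Recursive descriptions of the classes\<close>

lemma perm_class_0_0:
  "perm_class 0 (Suc j) 0 = {[]} \<union> glue_set (perm_class 0 j 0) (perm_class 0 (Suc j) 0)"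
  by (rule perm_class_eqI) (auto simp: glue_membership add_is_1, auto simp: glue_def glue132_def)

lemma perm_class_0_1_base:
  "perm_class 0 (Suc 0) (Suc 0) =
     glue_set {[]} (perm_class 0 (Suc 0) (Suc 0)) \<union>
     glue_set (perm_class 0 (Suc 0) 0 - {[]}) (perm_class 0 (Suc 0) 0)"
  by (rule perm_class_eqI) (auto simp: glue_membership add_is_1)

lemma perm_class_0_1:
  "perm_class 0 (Suc (Suc j)) (Suc 0) =
     glue_set (perm_class 0 (Suc j) 0) (perm_class 0 (Suc (Suc j)) (Suc 0)) \<union>
     glue_set (perm_class 0 (Suc j) (Suc 0)) (perm_class 0 (Suc (Suc j)) 0)"
  by (rule perm_class_eqI) (auto simp: glue_membership add_is_1)

text \<open>Words without ascents are decreasing and contain no 1-3-2, so the class is in fact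
  empty; the equation in this form makes its generating function vanish.\<close>

lemma perm_class_1_0_base:
  "perm_class (Suc 0) (Suc 0) 0 = glue_set {[]} (perm_class (Suc 0) (Suc 0) 0)"
  by (rule perm_class_eqI) (auto simp: glue_membership add_is_1)

lemma perm_class_1_0:
  "perm_class (Suc 0) (Suc (Suc j)) 0 =
     glue_set (perm_class (Suc 0) (Suc j) 0) (perm_class 0 (Suc (Suc j)) 0) \<union>
     glue_set (perm_class 0 (Suc j) 0) (perm_class (Suc 0) (Suc (Suc j)) 0) \<union>
     glue132_set (perm_class 0 (Suc j) 0) (perm_class 0 (Suc (Suc j)) 0 - {[]})"
  by (rule perm_class_eqI) (auto simp: glue_membership add_is_1)

lemma perm_class_1_1_base:
  "perm_class (Suc 0) (Suc 0) (Suc 0) =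
     glue_set {[]} (perm_class (Suc 0) (Suc 0) (Suc 0)) \<union>
     glue_set (perm_class (Suc 0) (Suc 0) 0) (perm_class 0 (Suc 0) 0) \<union>
     glue_set (perm_class 0 (Suc 0) 0 - {[]}) (perm_class (Suc 0) (Suc 0) 0) \<union>
     glue132_set (perm_class 0 (Suc 0) 0) (perm_class 0 (Suc 0) 0 - {[]})"
  by (rule perm_class_eqI) (auto simp: glue_membership add_is_1)

text \<open>Six terms: the 1-3-2 lies left of, right of or across the maximum, and independently the
  single occurrence counted by \<open>occ12\<close> comes from the left or the right factor.\<close>

lemma perm_class_1_1:
  "perm_class (Suc 0) (Suc (Suc j)) (Suc 0) =
     glue_set (perm_class (Suc 0) (Suc j) 0) (perm_class 0 (Suc (Suc j)) (Suc 0)) \<union>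
     glue_set (perm_class (Suc 0) (Suc j) (Suc 0)) (perm_class 0 (Suc (Suc j)) 0) \<union>
     glue_set (perm_class 0 (Suc j) 0) (perm_class (Suc 0) (Suc (Suc j)) (Suc 0)) \<union>
     glue_set (perm_class 0 (Suc j) (Suc 0)) (perm_class (Suc 0) (Suc (Suc j)) 0) \<union>
     glue132_set (perm_class 0 (Suc j) 0) (perm_class 0 (Suc (Suc j)) (Suc 0)) \<union>
     glue132_set (perm_class 0 (Suc j) (Suc 0)) (perm_class 0 (Suc (Suc j)) 0 - {[]})"
  by (rule perm_class_eqI) (auto simp: glue_membership add_is_1)

lemma perm_class_disjoint_Diff:
  "d \<noteq> d' \<or> c \<noteq> c' \<Longrightarrow> perm_class d j c \<inter> (perm_class d' j c' - S) = {}"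
  by (auto simp: perm_class_def)

lemma Nil_glue_disjoint: "{[]} \<inter> glue_set X Y = {}"
  by (simp add: Nil_notin_glue_set)

lemmas gf_simps = gf_Un gf_Nil gf_glue_set gf_glue132_set gf_minus_Nil glue_set_disjoint
  glue132_set_disjoint glue_set_glue132_set_disjoint perm_class_disjoint perm_class_disjoint_Diff
  Nil_glue_disjoint Nil_in_perm_class Int_Un_distrib2

section \<open>The four families of generating functions and their recurrences\<close>

abbreviation "gf_A j \<equiv> gf (perm_class 0 j 0)"
abbreviation "gf_B j \<equiv> gf (perm_class 0 j (Suc 0))"
abbreviation "gf_E j \<equiv> gf (perm_class (Suc 0) j 0)"
abbreviation "gf_F j \<equiv> gf (perm_class (Suc 0) j (Suc 0))"

lemma gf_A_0: "gf_A 0 = 1"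
proof -
  have "perm_class 0 0 0 = {[]}" by (auto simp: perm_class_def split: if_splits)
  then show ?thesis by (simp add: gf_Nil)
qed

lemma gf_A_Suc: "gf_A (Suc j) = 1 + fps_X * gf_A j * gf_A (Suc j)"
  by (rule trans[OF arg_cong[OF perm_class_0_0, of gf]]) (simp add: gf_simps del: Un_insert_left)

lemma gf_B_1: "gf_B (Suc 0) = fps_X * gf_B (Suc 0) + fps_X * (gf_A (Suc 0) - 1) * gf_A (Suc 0)"
  by (rule trans[OF arg_cong[OF perm_class_0_1_base, of gf]]) (simp add: gf_simps)

lemma gf_B_Suc:
  "gf_B (Suc (Suc j)) =
     fps_X * gf_A (Suc j) * gf_B (Suc (Suc j)) + fps_X * gf_B (Suc j) * gf_A (Suc (Suc j))"
  by (rule trans[OF arg_cong[OF perm_class_0_1, of gf]]) (simp add: gf_simps)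

lemma gf_E_1: "gf_E (Suc 0) = fps_X * gf_E (Suc 0)"
  by (rule trans[OF arg_cong[OF perm_class_1_0_base, of gf]]) (simp add: gf_simps)

lemma gf_E_Suc:
  "gf_E (Suc (Suc j)) =
     fps_X * gf_E (Suc j) * gf_A (Suc (Suc j)) + fps_X * gf_A (Suc j) * gf_E (Suc (Suc j)) +
     fps_X\<^sup>2 * gf_A (Suc j) * (gf_A (Suc (Suc j)) - 1)"
  by (rule trans[OF arg_cong[OF perm_class_1_0, of gf]]) (simp add: gf_simps)

lemma gf_F_1:
  "gf_F (Suc 0) =
     fps_X * gf_F (Suc 0) + fps_X * gf_E (Suc 0) * gf_A (Suc 0) +
     fps_X * (gf_A (Suc 0) - 1) * gf_E (Suc 0) + fps_X\<^sup>2 * gf_A (Suc 0) * (gf_A (Suc 0) - 1)"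
  by (rule trans[OF arg_cong[OF perm_class_1_1_base, of gf]]) (simp add: gf_simps)

lemma gf_F_Suc:
  "gf_F (Suc (Suc j)) =
     fps_X * gf_E (Suc j) * gf_B (Suc (Suc j)) + fps_X * gf_F (Suc j) * gf_A (Suc (Suc j)) +
     fps_X * gf_A (Suc j) * gf_F (Suc (Suc j)) + fps_X * gf_B (Suc j) * gf_E (Suc (Suc j)) +
     fps_X\<^sup>2 * gf_A (Suc j) * gf_B (Suc (Suc j)) +
     fps_X\<^sup>2 * gf_B (Suc j) * (gf_A (Suc (Suc j)) - 1)"
  by (rule trans[OF arg_cong[OF perm_class_1_1, of gf]]) (simp add: gf_simps)

lemma Phi_eq_gf: "Phi (pattern_12_3_k (Suc (Suc j))) = gf_F (Suc j)"
  unfolding Phi_def gf_def phi_eq_card_perm_words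
  by (intro arg_cong[where f = Abs_fps] ext arg_cong[where f = of_nat] arg_cong[where f = card])
    (auto simp: perm_class_def)

section \<open>Solving the recurrences\<close>

text \<open>The algebra is done for abstract sequences in a field, where division is available;
  Laurent series instantiate it later. \<open>r\<close> plays the reduced Chebyshev polynomials, the
  other letters the generating functions.\<close>

locale gf_recurrences =
  fixes x :: "'a :: field" and r a b e f :: "nat \<Rightarrow> 'a"
  assumes r: "r 0 = 1" "r (Suc 0) = 1" "\<And>p. r (Suc (Suc p)) = r (Suc p) - x * r p"
    and r_nz: "\<And>p. r p \<noteq> 0"
    and a: "a 0 = 1" "\<And>j. a (Suc j) = 1 + x * a j * a (Suc j)"
    and b: "b (Suc 0) = x * b (Suc 0) + x * (a (Suc 0) - 1) * a (Suc 0)"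
      "\<And>j. b (Suc (Suc j)) = x * a (Suc j) * b (Suc (Suc j)) + x * b (Suc j) * a (Suc (Suc j))"
    and e: "e (Suc 0) = x * e (Suc 0)"
      "\<And>j. e (Suc (Suc j)) = x * e (Suc j) * a (Suc (Suc j)) + x * a (Suc j) * e (Suc (Suc j)) +
        x\<^sup>2 * a (Suc j) * (a (Suc (Suc j)) - 1)"
    and f: "f (Suc 0) = x * f (Suc 0) + x * e (Suc 0) * a (Suc 0) +
        x * (a (Suc 0) - 1) * e (Suc 0) + x\<^sup>2 * a (Suc 0) * (a (Suc 0) - 1)"
      "\<And>j. f (Suc (Suc j)) = x * e (Suc j) * b (Suc (Suc j)) + x * f (Suc j) * a (Suc (Suc j)) +
        x * a (Suc j) * f (Suc (Suc j)) + x * b (Suc j) * e (Suc (Suc j)) +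
        x\<^sup>2 * a (Suc j) * b (Suc (Suc j)) + x\<^sup>2 * b (Suc j) * (a (Suc (Suc j)) - 1)"
begin

text \<open>The recurrence multiplies this determinant by \<open>x\<close> at each step, starting
  from \<open>x\<close> at \<open>p = 0\<close>.\<close>

lemma casoratian: "(r (Suc p))\<^sup>2 - r p * r (Suc (Suc p)) = x ^ Suc p"
proof (induction p)
  case 0
  show ?case using r by simp
next
  case (Suc p)
  have "(r (Suc (Suc p)))\<^sup>2 - r (Suc p) * r (Suc (Suc (Suc p))) =
      x * ((r (Suc p))\<^sup>2 - r p * r (Suc (Suc p)))"
    unfolding r(3)[of "Suc p"] by (simp add: r(3)[of p] power2_eq_square algebra_simps)
  then show ?case using Suc by simp
qed

lemma one_minus: "1 - x * (r j / r (Suc j)) = r (Suc (Suc j)) / r (Suc j)"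
  using r_nz[of "Suc j"] by (simp add: r(3) field_simps)

text \<open>Each recurrence contains its unknown with the coefficient \<open>x * a j\<close>; this
  isolates it.\<close>

lemma solve_linear:
  assumes "z = w + x * (r j / r (Suc j)) * z"
  shows "z = w * (r (Suc j) / r (Suc (Suc j)))"
proof -
  have "z * (1 - x * (r j / r (Suc j))) = w" using assms by (simp add: algebra_simps)
  then show ?thesis unfolding one_minus using r_nz by (simp add: field_simps)
qed

lemma a_eq: "a j = r j / r (Suc j)"
proof (induction j)
  case 0
  show ?case using a r by simp
next
  case (Suc j)
  have "a (Suc j) = 1 + x * (r j / r (Suc j)) * a (Suc j)" using a(2)[of j] Suc by simp
  from solve_linear[OF this] show ?case by simp
qed

lemma a_minus_1: "a (Suc j) - 1 = x * r j / r (Suc (Suc j))"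
  using r_nz[of "Suc (Suc j)"] unfolding a_eq by (simp add: field_simps r(3)[of j])

text \<open>Each step multiplies by \<open>x\<close> times the square of
  \<open>r (j + 2) / r (j + 3)\<close>, which telescopes; the factor \<open>r 2\<close> is left from
  the initial value.\<close>

lemma b_eq: "b (Suc j) = x ^ (j + 2) / (r 2 * (r (j + 2))\<^sup>2)"
proof (induction j)
  case 0
  have "b (Suc 0) = x * (a (Suc 0) - 1) * a (Suc 0) + x * (r 0 / r (Suc 0)) * b (Suc 0)"
    using b(1) r(1,2) by (simp add: add.commute)
  from solve_linear[OF this] show ?case
    using r_nz unfolding a_minus_1 unfolding a_eq by (simp add: r(1,2) numeral_2_eq_2 field_simps power2_eq_square)
next
  case (Suc j)
  have "b (Suc (Suc j)) = x * b (Suc j) * a (Suc (Suc j)) + x * (r (Suc j) / r (Suc (Suc j))) * b (Suc (Suc j))"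
    using b(2)[of j] unfolding a_eq by (simp only: ac_simps)
  from solve_linear[OF this] show ?case
    using r_nz unfolding Suc a_eq by (simp add: field_simps power2_eq_square)
qed

text \<open>The homogeneous part telescopes as for \<open>b\<close>; the \<open>glue132\<close> term
  of each step contributes one new summand.\<close>

lemma e_eq: "e (Suc j) = x ^ (j + 3) * (\<Sum>i = 1..j. (r i)\<^sup>2 / x ^ i) / (r (j + 2))\<^sup>2"
  if "x \<noteq> 0"
proof (induction j)
  case 0
  have "e (Suc 0) = 0 + x * (r 0 / r (Suc 0)) * e (Suc 0)"
    using e(1) r by simp
  from solve_linear[OF this] show ?case by simp
next
  case (Suc j)
  have "e (Suc (Suc j)) = (x * e (Suc j) * a (Suc (Suc j)) + x\<^sup>2 * a (Suc j) * (a (Suc (Suc j)) - 1)) +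
      x * (r (Suc j) / r (Suc (Suc j))) * e (Suc (Suc j))"
    using e(2)[of j] unfolding a_eq by (simp only: ac_simps)
  note solve_linear[OF this]
  also have "(x * e (Suc j) * a (Suc (Suc j)) + x\<^sup>2 * a (Suc j) * (a (Suc (Suc j)) - 1)) *
      (r (Suc (Suc j)) / r (Suc (Suc (Suc j)))) =
      (x * e (Suc j) * (r (j + 2))\<^sup>2 + x ^ 3 * (r (Suc j))\<^sup>2) / (r (j + 3))\<^sup>2"
    unfolding a_minus_1 unfolding a_eq
    using r_nz by (simp add: field_simps power2_eq_square power3_eq_cube numeral_eq_Suc)
  also have "x * e (Suc j) * (r (j + 2))\<^sup>2 = x ^ (j + 4) * (\<Sum>i = 1..j. (r i)\<^sup>2 / x ^ i)"
    using r_nz unfolding Suc by (simp add: numeral_eq_Suc)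
  also have "x ^ 3 * (r (Suc j))\<^sup>2 = x ^ (j + 4) * ((r (Suc j))\<^sup>2 / x ^ Suc j)"
    using that by (simp add: field_simps numeral_eq_Suc)
  finally show ?case by (simp add: distrib_left numeral_eq_Suc)
qed

lemma f_1: "f (Suc 0) = x ^ 3 / r 2 ^ 3"
proof -
  have "e (Suc 0) = 0 + x * (r 0 / r (Suc 0)) * e (Suc 0)"
    using e(1) r by simp
  from solve_linear[OF this] have [simp]: "e (Suc 0) = 0" by simp
  have "f (Suc 0) = x\<^sup>2 * a (Suc 0) * (a (Suc 0) - 1) + x * (r 0 / r (Suc 0)) * f (Suc 0)"
    using f(1) r(1,2) by (simp add: add.commute)
  from solve_linear[OF this] show ?thesis
    using r_nz unfolding a_minus_1 unfolding a_eq
    by (simp add: r(1,2) numeral_2_eq_2 numeral_3_eq_3 field_simps power2_eq_square)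
qed

text \<open>\<open>P\<close> is the bracket of the final formula accumulated so far; the step adds
  its term for \<open>i = j + 2\<close>.\<close>

lemma f_Suc:
  assumes x: "x \<noteq> 0" and f_eq: "f (Suc j) = x ^ (j + 3) / (r 2 * (r (j + 2))\<^sup>2) * P"
  shows "f (Suc (Suc j)) = x ^ (j + 4) / (r 2 * (r (j + 3))\<^sup>2) *
    (P + 2 * x ^ (j + 3) / (r (j + 2) * r (j + 3)) * ((\<Sum>i = 1..j + 2. (r i)\<^sup>2 / x ^ i) - 1))"
proof -
  define R1 R2 R3 \<rho> y where "R1 = r (Suc j)" and "R2 = r (Suc (Suc j))" and "R3 = r (Suc (Suc (Suc j)))"
    and "\<rho> = r 2" and "y = x ^ Suc (Suc j)"
  define S where "S = (\<Sum>i = 1..j. (r i)\<^sup>2 / x ^ i)"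
  have nz: "R1 \<noteq> 0" "R2 \<noteq> 0" "R3 \<noteq> 0" "\<rho> \<noteq> 0" "y \<noteq> 0"
    using r_nz x by (auto simp: R1_def R2_def R3_def \<rho>_def y_def)
  \<comment> \<open>The recurrence and the Casoratian identity are the links among the abbreviations
    that the computation uses; the rest is rational algebra.\<close>
  have xR1: "x * R1 = R2 - R3" unfolding R1_def R2_def R3_def using r(3)[of "Suc j"] by simp
  have y: "y = R2\<^sup>2 - R1 * R3"
    unfolding R1_def R2_def R3_def y_def using casoratian[of "Suc j"] by simp
  have S': "(\<Sum>i = 1..j + 2. (r i)\<^sup>2 / x ^ i) = S + x * R1\<^sup>2 / y + R2\<^sup>2 / y"
    using x by (simp add: S_def R1_def R2_def y_def)
  have b1: "b (Suc j) = y / (\<rho> * R2\<^sup>2)" and b2: "b (Suc (Suc j)) = x * y / (\<rho> * R3\<^sup>2)"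
    unfolding b_eq by (simp_all add: R2_def R3_def \<rho>_def y_def)
  have e1: "e (Suc j) = x * y * S / R2\<^sup>2"
    unfolding e_eq[OF x] by (simp add: S_def R2_def y_def numeral_eq_Suc)
  have e2: "e (Suc (Suc j)) = (x\<^sup>2 * y * S + x ^ 3 * R1\<^sup>2) / R3\<^sup>2"
  proof -
    have "x ^ (Suc j + 3) * (R1\<^sup>2 / x ^ Suc j) = x ^ 3 * R1\<^sup>2"
      using x by (simp add: power_add numeral_eq_Suc)
    then show ?thesis
      unfolding e_eq[OF x]
      by (simp add: S_def R1_def R3_def y_def distrib_left numeral_eq_Suc mult.assoc)
  qed
  have f1: "f (Suc j) = x * y * P / (\<rho> * R2\<^sup>2)"
    unfolding f_eq by (simp add: \<rho>_def R2_def y_def numeral_eq_Suc)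
  have a1: "a (Suc j) = R1 / R2" and a2: "a (Suc (Suc j)) = R2 / R3"
    by (simp_all add: a_eq R1_def R2_def R3_def)
  have a3: "a (Suc (Suc j)) - 1 = x * R1 / R3"
    unfolding a_minus_1 R1_def R3_def ..
  define W where "W = x * e (Suc j) * b (Suc (Suc j)) + x * f (Suc j) * a (Suc (Suc j)) +
    x * b (Suc j) * e (Suc (Suc j)) +
    x\<^sup>2 * a (Suc j) * b (Suc (Suc j)) + x\<^sup>2 * b (Suc j) * (a (Suc (Suc j)) - 1)"
  have "f (Suc (Suc j)) = W + x * (r (Suc j) / r (Suc (Suc j))) * f (Suc (Suc j))"
    using f(2)[of j] unfolding W_def a_eq[of "Suc j"] by (simp only: ac_simps)
  from solve_linear[OF this] have "f (Suc (Suc j)) = W * (R2 / R3)"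
    unfolding R2_def R3_def .
  also have "W * (R2 / R3) = x\<^sup>2 * y / (\<rho> * R3\<^sup>2) *
      (P + (2 * (x * y * S) + x\<^sup>2 * R1\<^sup>2 + x * R1 * R2 + x * R1 * R3) / (R2 * R3))"
    unfolding W_def b1 b2 e1 e2 f1 a3 unfolding a1 a2
    using nz by (simp add: divide_simps) (simp add: power2_eq_square power3_eq_cube algebra_simps)
  \<comment> \<open>The recurrence trades \<open>x * R1 * R2\<close> for terms in \<open>R1\<close>
    and \<open>R3\<close>, and the Casoratian turns \<open>R1 * R3\<close> into the square of
    \<open>R2\<close> minus \<open>y\<close>; this \<open>- y\<close> becomes the \<open>- 1\<close>
    of the bracket.\<close>
  also have "2 * (x * y * S) + x\<^sup>2 * R1\<^sup>2 + x * R1 * R2 + x * R1 * R3 =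
      2 * (x * y * S) + 2 * (x\<^sup>2 * R1\<^sup>2) + 2 * (x * (R2\<^sup>2 - y))"
  proof -
    have "x\<^sup>2 * R1\<^sup>2 + x * R1 * R2 + x * R1 * R3 = 2 * (x\<^sup>2 * R1\<^sup>2) + 2 * (x * R1 * R3)"
      using xR1 by algebra
    then show ?thesis unfolding y by (simp add: algebra_simps)
  qed
  also have "\<dots> = 2 * x * y * (S + x * R1\<^sup>2 / y + R2\<^sup>2 / y - 1)"
    using nz by (simp add: field_simps power2_eq_square)
  finally show ?thesis
    unfolding S' by (simp add: R2_def R3_def \<rho>_def y_def numeral_eq_Suc mult.assoc)
qed

end

text \<open>Squares turn powers of \<open>s\<close> into powers of \<open>x\<close>; in products of
  neighbouring \<open>u\<close> the factor \<open>s\<close> of \<open>2 * s\<close> completes an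
  even power.\<close>

lemma (in gf_recurrences) f_eq_chebyshev:
  assumes s: "x = s\<^sup>2" "s \<noteq> 0" and u: "\<And>p. u p = r p / s ^ p"
  shows "f (Suc j) = 1 / (u 2 * (u (j + 2))\<^sup>2) *
    (1 + (\<Sum>i = 2..j + 1. 2 * s / (u i * u (i + 1)) * ((\<Sum>l = 1..i. (u l)\<^sup>2) - 1)))"
proof -
  define P where "P j = 1 + (\<Sum>i = 2..j + 1. 2 * s / (u i * u (i + 1)) * ((\<Sum>l = 1..i. (u l)\<^sup>2) - 1))" for j
  have x: "x \<noteq> 0" using s by simp
  have u2: "(u l)\<^sup>2 = (r l)\<^sup>2 / x ^ l" for l
    by (simp add: u s power_divide flip: power_mult) (simp add: mult.commute)
  have prefactor: "1 / (u 2 * (u p)\<^sup>2) = x ^ (p + 1) / (r 2 * (r p)\<^sup>2)" for p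
    unfolding u2 by (simp add: u s)
  have factor: "2 * s / (u p * u (p + 1)) = 2 * x ^ (p + 1) / (r p * r (p + 1))" for p
    using s by (simp add: u power2_eq_square power_mult_distrib field_simps)
  have "f (Suc j) = x ^ (j + 3) / (r 2 * (r (j + 2))\<^sup>2) * P j"
  proof (induction j)
    case 0
    show ?case by (simp add: f_1 P_def power2_eq_square power3_eq_cube numeral_2_eq_2)
  next
    case (Suc j)
    have "P (Suc j) = P j + 2 * s / (u (j + 2) * u (j + 2 + 1)) *
        ((\<Sum>l = 1..j + 2. (u l)\<^sup>2) - 1)"
      by (simp add: P_def)
    then show ?case
      unfolding u2 factor using f_Suc[OF x Suc] by (simp add: numeral_eq_Suc)
  qed
  then show ?thesis unfolding P_def prefactor by (simp add: numeral_eq_Suc)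
qed

section \<open>Substituting the square of \<open>sqrt_x\<close>, and Chebyshev polynomials at
  Laurent series\<close>

lemma in_sqrt_x_hom:
  "in_sqrt_x 1 = 1"
  "in_sqrt_x (F + G) = in_sqrt_x F + in_sqrt_x G"
  "in_sqrt_x (F - G) = in_sqrt_x F - in_sqrt_x G"
  "in_sqrt_x (F * G) = in_sqrt_x F * in_sqrt_x G"
  "in_sqrt_x fps_X = sqrt_x\<^sup>2"
  unfolding in_sqrt_x_def sqrt_x_def
  by (simp_all add: fps_compose_add_distrib fps_compose_sub_distrib fps_compose_mult_distrib
      fls_times_fps_to_fls fps_to_fls_power)

lemma in_sqrt_x_power: "in_sqrt_x (F ^ n) = in_sqrt_x F ^ n"
  by (induction n) (simp_all add: in_sqrt_x_hom)

text \<open>The substitution leaves the constant term unchanged.\<close>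

lemma in_sqrt_x_nonzero: "F $ 0 \<noteq> 0 \<Longrightarrow> in_sqrt_x F \<noteq> 0"
proof
  assume F: "F $ 0 \<noteq> 0" and "in_sqrt_x F = 0"
  then have "(F oo fps_X\<^sup>2) $ 0 = 0" by (simp add: in_sqrt_x_def)
  then show False using F by simp
qed

text \<open>\<open>reduced_U p\<close> is \<open>x\<^bsup>p/2\<^esup> U\<^sub>p(1/(2\<surd>x))\<close>, a polynomial in \<open>x\<close>.\<close>

fun reduced_U :: "nat \<Rightarrow> real fps" where
  "reduced_U 0 = 1"
| "reduced_U (Suc 0) = 1"
| "reduced_U (Suc (Suc p)) = reduced_U (Suc p) - fps_X * reduced_U p"

lemma reduced_U_nth_0: "reduced_U p $ 0 = 1"
  by (induction p rule: reduced_U.induct) auto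

lemma chebyshev_U_at_rec:
  "chebyshev_U_at 0 t = 1"
  "chebyshev_U_at (Suc 0) t = 2 * t"
  "chebyshev_U_at (Suc (Suc p)) t = 2 * t * chebyshev_U_at (Suc p) t - chebyshev_U_at p t"
proof -
  have "map_poly fls_const (chebyshev_U_rec (Suc (Suc p))) =
      pCons 0 (smult 2 (map_poly fls_const (chebyshev_U_rec (Suc p))))
        - map_poly fls_const (chebyshev_U_rec p)"
    by (rule poly_eqI) (auto simp: coeff_map_poly coeff_pCons fls_minus_const fls_const_mult_const
        split: nat.split simp flip: fls_const_numeral)
  then show "chebyshev_U_at (Suc (Suc p)) t = 2 * t * chebyshev_U_at (Suc p) t - chebyshev_U_at p t"
    by (simp add: chebyshev_U_at_def chebyshev_U_eq_rec mult.assoc mult.left_commute)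
qed (simp_all add: chebyshev_U_at_def chebyshev_U_eq_rec map_poly_pCons)

text \<open>At this argument \<open>2 * t\<close> is \<open>1 / sqrt_x\<close>, so scaling by
  \<open>sqrt_x ^ p\<close> turns the Chebyshev recurrence into that of
  \<open>reduced_U\<close>.\<close>

lemma chebyshev_U_at_sqrt_x:
  "chebyshev_U_at p (1 / (2 * sqrt_x)) = in_sqrt_x (reduced_U p) / sqrt_x ^ p"
proof -
  have t: "2 * (1 / (2 * sqrt_x)) = 1 / sqrt_x" by simp
  have nz: "sqrt_x \<noteq> 0" by (simp add: sqrt_x_def)
  show ?thesis
  proof (induction p rule: reduced_U.induct)
    case (3 p)
    show ?case
      unfolding chebyshev_U_at_rec t 3 using nz
      by (simp add: in_sqrt_x_hom power2_eq_square field_simps)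
  qed (simp_all add: chebyshev_U_at_rec t in_sqrt_x_hom)
qed

theorem theorem5p1:
  fixes k :: nat
  assumes "k \<ge> 2"
  shows "let t = 1 / (2 * sqrt_x); U = (\<lambda>p. chebyshev_U_at p t) in
    in_sqrt_x (Phi (pattern_12_3_k k)) =
      1 / (U 2 * (U k)\<^sup>2) *
      (1 + (\<Sum>i = 2..k - 1. 2 * sqrt_x / (U i * U (i + 1)) * ((\<Sum>j = 1..i. (U j)\<^sup>2) - 1)))"
proof -
  \<comment> \<open>Pattern length \<open>k\<close> corresponds to the index
    \<open>k - 1 = Suc j\<close> of \<open>gf_F\<close>.\<close>
  define j where "j = k - 2"
  have k: "k = j + 2" using assms by (simp add: j_def)
  \<comment> \<open>\<open>in_sqrt_x\<close> respects sums, differences and products, so it carries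
    the power series recurrences into the field of Laurent series; constant term 1 keeps the images
    of \<open>reduced_U\<close> nonzero.\<close>
  interpret gf_recurrences "in_sqrt_x fps_X" "\<lambda>p. in_sqrt_x (reduced_U p)"
    "\<lambda>j. in_sqrt_x (gf_A j)" "\<lambda>j. in_sqrt_x (gf_B j)" "\<lambda>j. in_sqrt_x (gf_E j)" "\<lambda>j. in_sqrt_x (gf_F j)"
  proof
    show "in_sqrt_x (reduced_U p) \<noteq> 0" for p
      by (rule in_sqrt_x_nonzero) (simp add: reduced_U_nth_0)
  qed (simp_all only: reduced_U.simps in_sqrt_x_hom(1,3,4) gf_A_0,
      simp_all only: in_sqrt_x_hom(1-4)[symmetric] in_sqrt_x_power[symmetric],
      (rule arg_cong[where f = in_sqrt_x] gf_A_Suc gf_B_1 gf_B_Suc gf_E_1 gf_E_Suc gf_F_1 gf_F_Suc)+)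
  have nz: "sqrt_x \<noteq> 0" by (simp add: sqrt_x_def)
  show ?thesis
    unfolding Let_def k
    using f_eq_chebyshev[OF in_sqrt_x_hom(5) nz chebyshev_U_at_sqrt_x, of j] Phi_eq_gf[of j]
    by simp
qed

end
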